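(* Let $N\ge 2$ and let $q$ be a nonzero complex number. For $\alpha,\beta\in\mathbb{Z}^{N-1}$ let $$\mathcal{A}[\alpha,\beta]=\{x\in\mathcal{O}(SL_q(N)) : L_K(x)=z^{\alpha}\otimes x,\ R_K(x)=x\otimes z^{\beta}\}.$$ Then, as a vector space, $$\mathcal{O}(SL_q(N))=\bigoplus_{\alpha,\beta\in\mathbb{Z}^{N-1}}\mathcal{A}[\alpha,\beta].$$
   Context: $\mathcal{O}(SL_q(N))$ (also written $SL_q(N)$) is the standard quantized coordinate Hopf algebra over $\mathbb{C}$: it is the unital algebra generated by $u_{i,j}$, $1\le i,j\le N$, subject to $u_{ik}u_{jk}=q\,u_{jk}u_{ik}$ and $u_{ki}u_{kj}=q\,u_{kj}u_{ki}$ for $i<j$; $u_{il}u_{jk}=u_{jk}u_{il}$ and $u_{ik}u_{jl}-u_{jl}u_{ik}=(q-q^{-1})u_{il}u_{jk}$ for $i<j$, $k<l$; and the quantum determinant relation $\sum_{\sigma\in S_N}(-q)^{\mathrm{len}(\sigma)}u_{1,\sigma(1)}\cdots u_{N,\sigma(N)}=1$, where $\mathrm{len}(\sigma)$ is the number of inversions of $\sigma$. The coproduct is the algebra homomorphism with $\Delta(u_{i,j})=\sum_k u_{i,k}\otimes u_{k,j}$ and the counit satisfies $\epsilon(u_{i,j})=\delta_{ij}$. $\mathcal{O}(K_N)=\mathbb{C}[z_1,\dots,z_N]/\langle z_1\cdots z_N=1\rangle$ is the coordinate algebra of the maximal torus of $SL(N,\mathbb{C})$, a Hopf algebra with $\Delta(z_j)=z_j\otimes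 z_j$, $\epsilon(z_j)=1$, $S(z_j)=z_j^{-1}$. Since $z_N=z_1^{-1}\cdots z_{N-1}^{-1}$, it is the Laurent polynomial algebra in $z_1,\dots,z_{N-1}$. For $\alpha\in\mathbb{Z}^{N-1}$ put $z^{\alpha}=\prod_{i=1}^{N-1}z_i^{\alpha_i}$. $\phi:\mathcal{O}(SL_q(N))\to\mathcal{O}(K_N)$ is the Hopf algebra homomorphism with $\phi(u_{i,j})=\delta_{ij}z_j$. The maps $L_K:\mathcal{O}(SL_q(N))\to\mathcal{O}(K_N)\otimes\mathcal{O}(SL_q(N))$ and $R_K:\mathcal{O}(SL_q(N))\to\mathcal{O}(SL_q(N))\otimes\mathcal{O}(K_N)$ are the algebra homomorphisms $L_K=(\phi\otimes\mathrm{id})\circ\Delta$ and $R_K=(\mathrm{id}\otimes\phi)\circ\Delta$. *)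

theory Defs
  imports
    Complex_Main
    "HOL-Library.Poly_Mapping"
    "HOL-Combinatorics.Permutations"
    "HOL-Algebra.Module"
    "HOL-Algebra.QuotRing"
begin

section \<open>Complex algebras\<close>

text \<open>A complex algebra is represented by a record of type \<open>(complex, 'a) module\<close>, which has
  both the ring operations and a scalar multiplication.\<close>

type_synonym 'a calg = "(complex, 'a) module"

definition complex_ring :: "complex ring" where
  "complex_ring = \<lparr>carrier = UNIV, mult = (*), one = 1, zero = 0, add = (+)\<rparr>"

definition alg_hom :: "'a calg \<Rightarrow> 'b calg \<Rightarrow> ('a \<Rightarrow> 'b) set" where
  "alg_hom A B =
     {h \<in> ring_hom A B. \<forall>c. \<forall>x\<in>carrier A. h (c \<odot>\<^bsub>A\<^esub> x) = c \<odot>\<^bsub>B\<^esub> h x}"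

text \<open>The monoid algebra: finitely supported formal linear combinations of elements of a monoid
  \<open>M\<close>, with the multiplication of \<open>M\<close> extended bilinearly.\<close>

definition monoid_algebra :: "('m, 'z) monoid_scheme \<Rightarrow> ('m \<Rightarrow>\<^sub>0 complex) calg" where
  "monoid_algebra M =
     \<lparr>carrier = {p. Poly_Mapping.keys p \<subseteq> carrier M},
      mult = (\<lambda>p r. \<Sum>a\<in>Poly_Mapping.keys p. \<Sum>b\<in>Poly_Mapping.keys r.
                Poly_Mapping.single (a \<otimes>\<^bsub>M\<^esub> b) (Poly_Mapping.lookup p a * Poly_Mapping.lookup r b)),
      one = Poly_Mapping.single \<one>\<^bsub>M\<^esub> 1,
      zero = 0,
      add = (+),
      smult = (\<lambda>c p. Poly_Mapping.map ((*) c) p)\<rparr>"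

definition free_monoid :: "'x set \<Rightarrow> 'x list monoid" where
  "free_monoid X = \<lparr>carrier = lists X, mult = (@), one = []\<rparr>"

definition free_comm_monoid :: "'x set \<Rightarrow> ('x \<Rightarrow>\<^sub>0 nat) monoid" where
  "free_comm_monoid X = \<lparr>carrier = {m. Poly_Mapping.keys m \<subseteq> X}, mult = (+), one = 0\<rparr>"

definition free_algebra :: "'x set \<Rightarrow> ('x list \<Rightarrow>\<^sub>0 complex) calg" where
  "free_algebra X = monoid_algebra (free_monoid X)"

definition polynomial_algebra :: "'x set \<Rightarrow> (('x \<Rightarrow>\<^sub>0 nat) \<Rightarrow>\<^sub>0 complex) calg" where
  "polynomial_algebra X = monoid_algebra (free_comm_monoid X)"

definition quotient_algebra :: "'a calg \<Rightarrow> 'a set \<Rightarrow> 'a set calg" where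
  "quotient_algebra A I =
     \<lparr>carrier = carrier (A Quot I),
      mult = mult (A Quot I),
      one = \<one>\<^bsub>A Quot I\<^esub>,
      zero = \<zero>\<^bsub>A Quot I\<^esub>,
      add = add (A Quot I),
      smult = (\<lambda>c X. \<Union>x\<in>X. I +>\<^bsub>A\<^esub> (c \<odot>\<^bsub>A\<^esub> x))\<rparr>"


section \<open>Tensor products\<close>

definition bilinear_relators :: "'a calg \<Rightarrow> 'b calg \<Rightarrow> ('a \<times> 'b \<Rightarrow>\<^sub>0 complex) set" where
  "bilinear_relators A B =
     {Poly_Mapping.single (a \<oplus>\<^bsub>A\<^esub> a', b) 1 - Poly_Mapping.single (a, b) 1
        - Poly_Mapping.single (a', b) 1 | a a' b.
        a \<in> carrier A \<and> a' \<in> carrier A \<and> b \<in> carrier B}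
   \<union> {Poly_Mapping.single (a, b \<oplus>\<^bsub>B\<^esub> b') 1 - Poly_Mapping.single (a, b) 1
        - Poly_Mapping.single (a, b') 1 | a b b'.
        a \<in> carrier A \<and> b \<in> carrier B \<and> b' \<in> carrier B}
   \<union> {Poly_Mapping.single (c \<odot>\<^bsub>A\<^esub> a, b) 1 - Poly_Mapping.single (a, b) c | c a b.
        a \<in> carrier A \<and> b \<in> carrier B}
   \<union> {Poly_Mapping.single (a, c \<odot>\<^bsub>B\<^esub> b) 1 - Poly_Mapping.single (a, b) c | c a b.
        a \<in> carrier A \<and> b \<in> carrier B}"

text \<open>\<open>monoid_algebra (A \<times>\<times> B)\<close> is the free vector space on \<open>carrier A \<times> carrier B\<close>, multiplied
  by \<open>(a, b) (a', b') = (a a', b b')\<close> on the basis; the linear span of the bilinear relators is a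
  two-sided ideal of it.\<close>

definition tensor_kernel :: "'a calg \<Rightarrow> 'b calg \<Rightarrow> ('a \<times> 'b \<Rightarrow>\<^sub>0 complex) set" where
  "tensor_kernel A B =
     \<Inter>{H. submodule H complex_ring (monoid_algebra (A \<times>\<times> B)) \<and> bilinear_relators A B \<subseteq> H}"

definition tensor_algebra ::
    "'a calg \<Rightarrow> 'b calg \<Rightarrow> ('a \<times> 'b \<Rightarrow>\<^sub>0 complex) set calg" where
  "tensor_algebra A B = quotient_algebra (monoid_algebra (A \<times>\<times> B)) (tensor_kernel A B)"

definition tensor_class ::
    "'a calg \<Rightarrow> 'b calg \<Rightarrow> ('a \<times> 'b \<Rightarrow>\<^sub>0 complex) \<Rightarrow> ('a \<times> 'b \<Rightarrow>\<^sub>0 complex) set" where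
  "tensor_class A B p = tensor_kernel A B +>\<^bsub>monoid_algebra (A \<times>\<times> B)\<^esub> p"

definition pure_tensor :: "'a calg \<Rightarrow> 'b calg \<Rightarrow> 'a \<Rightarrow> 'b \<Rightarrow> ('a \<times> 'b \<Rightarrow>\<^sub>0 complex) set" where
  "pure_tensor A B a b = tensor_class A B (Poly_Mapping.single (a, b) 1)"

text \<open>\<open>tensor_map C D f g\<close> is \<open>f \<otimes> g\<close>, where \<open>C\<close> and \<open>D\<close> are the codomains of the linear maps
  \<open>f\<close> and \<open>g\<close>. For linear \<open>f\<close> and \<open>g\<close> all members of the union are the same coset.\<close>

definition tensor_map ::
    "'c calg \<Rightarrow> 'd calg \<Rightarrow> ('a \<Rightarrow> 'c) \<Rightarrow> ('b \<Rightarrow> 'd)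
       \<Rightarrow> ('a \<times> 'b \<Rightarrow>\<^sub>0 complex) set \<Rightarrow> ('c \<times> 'd \<Rightarrow>\<^sub>0 complex) set" where
  "tensor_map C D f g X =
     (\<Union>p\<in>X. tensor_class C D
        (\<Sum>(a, b)\<in>Poly_Mapping.keys p. Poly_Mapping.single (f a, g b) (Poly_Mapping.lookup p (a, b))))"


section \<open>Internal direct sums\<close>

definition internal_direct_sum ::
    "('r, 'z) ring_scheme \<Rightarrow> ('r, 'a) module \<Rightarrow> 'i set \<Rightarrow> ('i \<Rightarrow> 'a set) \<Rightarrow> bool" where
  "internal_direct_sum R V I W \<longleftrightarrow>
     (\<forall>i\<in>I. submodule (W i) R V) \<and>
     (\<forall>x\<in>carrier V. \<exists>!f. f \<in> (\<Pi>\<^sub>E i\<in>I. W i) \<and> finite {i\<in>I. f i \<noteq> \<zero>\<^bsub>V\<^esub>} \<and>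
        x = (\<Oplus>\<^bsub>V\<^esub>i\<in>{i\<in>I. f i \<noteq> \<zero>\<^bsub>V\<^esub>}. f i))"


section \<open>The quantized coordinate algebra of \<open>SL(N)\<close>\<close>

text \<open>The word \<open>[(i, j), (k, l)]\<close> stands for \<open>u\<^sub>i\<^sub>j u\<^sub>k\<^sub>l\<close>.\<close>

definition inversions :: "nat \<Rightarrow> (nat \<Rightarrow> nat) \<Rightarrow> nat" where
  "inversions N \<sigma> = card {(i, j). 1 \<le> i \<and> i < j \<and> j \<le> N \<and> \<sigma> j < \<sigma> i}"

definition quantum_det :: "nat \<Rightarrow> complex \<Rightarrow> (nat \<times> nat) list \<Rightarrow>\<^sub>0 complex" where
  "quantum_det N q =
     (\<Sum>\<sigma> | \<sigma> permutes {1..N}.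
        Poly_Mapping.single (map (\<lambda>i. (i, \<sigma> i)) [1..<Suc N]) ((- q) ^ inversions N \<sigma>))"

definition slq_relators :: "nat \<Rightarrow> complex \<Rightarrow> ((nat \<times> nat) list \<Rightarrow>\<^sub>0 complex) set" where
  "slq_relators N q =
     {Poly_Mapping.single [(i, k), (j, k)] 1 - Poly_Mapping.single [(j, k), (i, k)] q | i j k.
        i \<in> {1..N} \<and> j \<in> {1..N} \<and> k \<in> {1..N} \<and> i < j}
   \<union> {Poly_Mapping.single [(k, i), (k, j)] 1 - Poly_Mapping.single [(k, j), (k, i)] q | i j k.
        i \<in> {1..N} \<and> j \<in> {1..N} \<and> k \<in> {1..N} \<and> i < j}
   \<union> {Poly_Mapping.single [(i, l), (j, k)] 1 - Poly_Mapping.single [(j, k), (i, l)] 1 | i j k l.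
        i \<in> {1..N} \<and> j \<in> {1..N} \<and> k \<in> {1..N} \<and> l \<in> {1..N} \<and> i < j \<and> k < l}
   \<union> {Poly_Mapping.single [(i, k), (j, l)] 1 - Poly_Mapping.single [(j, l), (i, k)] 1
        - Poly_Mapping.single [(i, l), (j, k)] (q - inverse q) | i j k l.
        i \<in> {1..N} \<and> j \<in> {1..N} \<and> k \<in> {1..N} \<and> l \<in> {1..N} \<and> i < j \<and> k < l}
   \<union> {quantum_det N q - Poly_Mapping.single [] 1}"

definition slq_ideal :: "nat \<Rightarrow> complex \<Rightarrow> ((nat \<times> nat) list \<Rightarrow>\<^sub>0 complex) set" where
  "slq_ideal N q = Idl\<^bsub>free_algebra ({1..N} \<times> {1..N})\<^esub> (slq_relators N q)"

type_synonym slq = "((nat \<times> nat) list \<Rightarrow>\<^sub>0 complex) set"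

definition SLq :: "nat \<Rightarrow> complex \<Rightarrow> slq calg" where
  "SLq N q = quotient_algebra (free_algebra ({1..N} \<times> {1..N})) (slq_ideal N q)"

definition slq_gen :: "nat \<Rightarrow> complex \<Rightarrow> nat \<Rightarrow> nat \<Rightarrow> slq" where
  "slq_gen N q i j =
     slq_ideal N q +>\<^bsub>free_algebra ({1..N} \<times> {1..N})\<^esub> Poly_Mapping.single [(i, j)] 1"

text \<open>Since the \<open>u\<^sub>i\<^sub>j\<close> generate the algebra, an algebra homomorphism is determined on the
  carrier by its values on them; the next predicate thus specifies the coproduct up to its
  irrelevant values outside the carrier.\<close>

definition is_slq_coproduct ::
    "nat \<Rightarrow> complex \<Rightarrow> (slq \<Rightarrow> (slq \<times> slq \<Rightarrow>\<^sub>0 complex) set) \<Rightarrow> bool" where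
  "is_slq_coproduct N q \<Delta> \<longleftrightarrow>
     \<Delta> \<in> alg_hom (SLq N q) (tensor_algebra (SLq N q) (SLq N q)) \<and>
     (\<forall>i\<in>{1..N}. \<forall>j\<in>{1..N}.
        \<Delta> (slq_gen N q i j) =
          (\<Oplus>\<^bsub>tensor_algebra (SLq N q) (SLq N q)\<^esub>k\<in>{1..N}.
             pure_tensor (SLq N q) (SLq N q) (slq_gen N q i k) (slq_gen N q k j)))"


section \<open>The coordinate algebra of the maximal torus\<close>

type_synonym torus = "((nat \<Rightarrow>\<^sub>0 nat) \<Rightarrow>\<^sub>0 complex) set"

definition torus_ideal :: "nat \<Rightarrow> ((nat \<Rightarrow>\<^sub>0 nat) \<Rightarrow>\<^sub>0 complex) set" where
  "torus_ideal N = Idl\<^bsub>polynomial_algebra {1..N}\<^esub>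
     {Poly_Mapping.single (\<Sum>j\<in>{1..N}. Poly_Mapping.single j 1) 1 - Poly_Mapping.single 0 1}"

definition Torus :: "nat \<Rightarrow> torus calg" where
  "Torus N = quotient_algebra (polynomial_algebra {1..N}) (torus_ideal N)"

definition torus_gen :: "nat \<Rightarrow> nat \<Rightarrow> torus" where
  "torus_gen N j =
     torus_ideal N +>\<^bsub>polynomial_algebra {1..N}\<^esub> Poly_Mapping.single (Poly_Mapping.single j 1) 1"

text \<open>\<open>\<int>\<^sup>N\<^sup>-\<^sup>1\<close>, as integer functions on \<open>{1, \<dots>, N - 1}\<close>.\<close>

definition weights :: "nat \<Rightarrow> (nat \<Rightarrow> int) set" where
  "weights N = {1..<N} \<rightarrow>\<^sub>E UNIV"

definition torus_monom :: "nat \<Rightarrow> (nat \<Rightarrow> int) \<Rightarrow> torus" where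
  "torus_monom N \<alpha> = (\<Otimes>\<^bsub>Torus N\<^esub>i\<in>{1..<N}. torus_gen N i [^]\<^bsub>Torus N\<^esub> \<alpha> i)"

definition is_torus_restriction :: "nat \<Rightarrow> complex \<Rightarrow> (slq \<Rightarrow> torus) \<Rightarrow> bool" where
  "is_torus_restriction N q \<phi> \<longleftrightarrow>
     \<phi> \<in> alg_hom (SLq N q) (Torus N) \<and>
     (\<forall>i\<in>{1..N}. \<forall>j\<in>{1..N}.
        \<phi> (slq_gen N q i j) = (if i = j then torus_gen N j else \<zero>\<^bsub>Torus N\<^esub>))"


section \<open>Torus coactions and weight spaces\<close>

definition left_coaction ::
    "nat \<Rightarrow> complex \<Rightarrow> (slq \<Rightarrow> (slq \<times> slq \<Rightarrow>\<^sub>0 complex) set) \<Rightarrow> (slq \<Rightarrow> torus)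
       \<Rightarrow> slq \<Rightarrow> (torus \<times> slq \<Rightarrow>\<^sub>0 complex) set" where
  "left_coaction N q \<Delta> \<phi> = tensor_map (Torus N) (SLq N q) \<phi> id \<circ> \<Delta>"

definition right_coaction ::
    "nat \<Rightarrow> complex \<Rightarrow> (slq \<Rightarrow> (slq \<times> slq \<Rightarrow>\<^sub>0 complex) set) \<Rightarrow> (slq \<Rightarrow> torus)
       \<Rightarrow> slq \<Rightarrow> (slq \<times> torus \<Rightarrow>\<^sub>0 complex) set" where
  "right_coaction N q \<Delta> \<phi> = tensor_map (SLq N q) (Torus N) id \<phi> \<circ> \<Delta>"

definition weight_space ::
    "nat \<Rightarrow> complex \<Rightarrow> (slq \<Rightarrow> (slq \<times> slq \<Rightarrow>\<^sub>0 complex) set) \<Rightarrow> (slq \<Rightarrow> torus)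
       \<Rightarrow> (nat \<Rightarrow> int) \<Rightarrow> (nat \<Rightarrow> int) \<Rightarrow> slq set" where
  "weight_space N q \<Delta> \<phi> \<alpha> \<beta> =
     {x \<in> carrier (SLq N q).
        left_coaction N q \<Delta> \<phi> x = pure_tensor (Torus N) (SLq N q) (torus_monom N \<alpha>) x \<and>
        right_coaction N q \<Delta> \<phi> x = pure_tensor (SLq N q) (Torus N) x (torus_monom N \<beta>)}"

end

theory Submission
  imports Defs
begin

text \<open>A word in the generators \<open>u\<^sub>i\<^sub>j\<close> is a simultaneous weight vector: its left weight counts the row
  indices of its letters and its right weight the column indices, where \<open>z\<^sub>N\<close> is eliminated by
  subtracting the number of indices equal to \<open>N\<close> from the other counts. Words span the algebra,
  so the weight spaces do. They are independent because the functional \<open>e\<^sub>\<alpha>\<close> on the torus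
  algebra that extracts the coefficient of \<open>z\<^sup>\<alpha>\<close> yields a linear map \<open>(e\<^sub>\<alpha> \<otimes> id) \<circ> L\<^sub>K\<close> which fixes
  the vectors of left weight \<open>\<alpha>\<close> and kills those of every other left weight, and similarly on
  the right.\<close>

section \<open>Linear extension\<close>

text \<open>The overview takes the coefficient functional on the torus algebra for granted. That
  algebra is a quotient, so reading off a coefficient presupposes that the monomials with different
  integer exponents stay independent in it. The way out is to send an exponent vector to its weight:
  this gives an algebra homomorphism from polynomials to the monoid algebra of Z^(N-1), where
  coefficients are visible, and since z_1...z_N has weight 0 the defining relation is killed and the
  coefficient descends. The form of the proof comes from the encoding. Quotients and tensor products
  consist of cosets, so a map out of them needs representatives and a proof that their choice does
  not matter. Every map is therefore first a linear extension on finitely supported functions, total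
  on the type and with laws free of carrier conditions. It passes to cosets once it is known to
  carry one subspace into another.\<close>

definition scale :: "complex \<Rightarrow> ('a \<Rightarrow>\<^sub>0 complex) \<Rightarrow> ('a \<Rightarrow>\<^sub>0 complex)" where
  "scale c p = Poly_Mapping.map ((*) c) p"

lemma lookup_scale [simp]: "Poly_Mapping.lookup (scale c p) k = c * Poly_Mapping.lookup p k"
  by (simp add: scale_def Poly_Mapping.map.rep_eq when_def)

lemma scale_single [simp]: "scale c (Poly_Mapping.single a d) = Poly_Mapping.single a (c * d)"
  by (rule poly_mapping_eqI) (simp add: lookup_single when_def)

lemma scale_add_left: "scale (c + d) p = scale c p + scale d p"
  and scale_add_right: "scale c (p + r) = scale c p + scale c r"
  and scale_scale [simp]: "scale c (scale d p) = scale (c * d) p"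
  and scale_zero_left [simp]: "scale 0 p = 0"
  and scale_zero_right [simp]: "scale c 0 = 0"
  and scale_one [simp]: "scale 1 p = p"
  and scale_minus_one: "scale (- 1) p = - p"
  by (rule poly_mapping_eqI, simp add: lookup_add lookup_minus algebra_simps)+

lemma scale_sum: "scale c (sum f S) = (\<Sum>i\<in>S. scale c (f i))"
  by (induction S rule: infinite_finite_induct) (simp_all add: scale_add_right)

lemma keys_scale: "Poly_Mapping.keys (scale c p) \<subseteq> Poly_Mapping.keys p"
  by (auto simp: in_keys_iff)

text \<open>Subspaces of the full type, with no reference to a carrier. Submodules and ideals of a
  monoid algebra are shown to be of this kind, which makes them accessible to
  \<open>lin_ext\<close>.\<close>

definition lin_subspace :: "('a \<Rightarrow>\<^sub>0 complex) set \<Rightarrow> bool" where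
  "lin_subspace S \<longleftrightarrow> 0 \<in> S \<and> (\<forall>p\<in>S. \<forall>r\<in>S. p + r \<in> S) \<and> (\<forall>c. \<forall>p\<in>S. scale c p \<in> S)"

lemma lin_subspaceD:
  assumes "lin_subspace S"
  shows "0 \<in> S" and "p \<in> S \<Longrightarrow> r \<in> S \<Longrightarrow> p + r \<in> S" and "p \<in> S \<Longrightarrow> scale c p \<in> S"
  using assms by (auto simp: lin_subspace_def)

lemma lin_subspace_diff:
  assumes "lin_subspace S" "p \<in> S" "r \<in> S"
  shows "p - r \<in> S"
  using lin_subspaceD(2)[OF assms(1,2) lin_subspaceD(3)[OF assms(1,3), of "- 1"]]
  by (simp add: scale_minus_one)

lemma lin_subspace_sum:
  assumes "lin_subspace S" "\<And>i. i \<in> J \<Longrightarrow> f i \<in> S"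
  shows "sum f J \<in> S"
  using assms(2) by (induction J rule: infinite_finite_induct) (auto intro: lin_subspaceD[OF assms(1)])

lemma lin_subspace_keys: "lin_subspace {p. Poly_Mapping.keys p \<subseteq> X}"
  unfolding lin_subspace_def by (auto dest!: subsetD[OF keys_add] subsetD[OF keys_scale])

text \<open>Products, induced homomorphisms and tensor maps are all written in this form, so that
  their laws reduce to identities between basis elements.\<close>

definition lin_ext :: "('a \<Rightarrow> 'b \<Rightarrow>\<^sub>0 complex) \<Rightarrow> ('a \<Rightarrow>\<^sub>0 complex) \<Rightarrow> ('b \<Rightarrow>\<^sub>0 complex)" where
  "lin_ext f p = (\<Sum>a\<in>Poly_Mapping.keys p. scale (Poly_Mapping.lookup p a) (f a))"

text \<open>Keys outside the support have coefficient zero. Cancellation can shrink the support of a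
  sum, so sums over different supports are compared over one common finite set.\<close>

lemma lin_ext_superset:
  assumes "finite S" "Poly_Mapping.keys p \<subseteq> S"
  shows "lin_ext f p = (\<Sum>a\<in>S. scale (Poly_Mapping.lookup p a) (f a))"
  unfolding lin_ext_def by (rule sum.mono_neutral_left) (use assms in \<open>auto simp: in_keys_iff\<close>)

lemma lin_ext_add: "lin_ext f (p + r) = lin_ext f p + lin_ext f r"
proof -
  let ?S = "Poly_Mapping.keys p \<union> Poly_Mapping.keys r"
  have "Poly_Mapping.keys (p + r) \<subseteq> ?S"
    by (rule keys_add)
  then show ?thesis
    by (simp add: lin_ext_superset[of ?S] lookup_add scale_add_left sum.distrib)
qed

lemma lin_ext_scale: "lin_ext f (scale c p) = scale c (lin_ext f p)"
  using keys_scale[of c p]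
  by (simp add: lin_ext_superset[of "Poly_Mapping.keys p"] scale_sum)

lemma lin_ext_zero [simp]: "lin_ext f 0 = 0"
  by (simp add: lin_ext_def)

lemma lin_ext_diff: "lin_ext f (p - r) = lin_ext f p - lin_ext f r"
  using lin_ext_add[of f "p - r" r] by simp

lemma lin_ext_sum: "lin_ext f (sum g S) = (\<Sum>i\<in>S. lin_ext f (g i))"
  by (induction S rule: infinite_finite_induct) (simp_all add: lin_ext_add)

lemma lin_ext_single [simp]: "lin_ext f (Poly_Mapping.single a c) = scale c (f a)"
  by (subst lin_ext_superset[of "{a}"]) (auto simp: keys_single)

lemma lin_ext_cong:
  assumes "\<And>a. a \<in> Poly_Mapping.keys p \<Longrightarrow> f a = g a"
  shows "lin_ext f p = lin_ext g p"
  using assms by (simp add: lin_ext_def)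

lemma lin_ext_mem:
  assumes "lin_subspace S" "\<And>a. a \<in> Poly_Mapping.keys p \<Longrightarrow> f a \<in> S"
  shows "lin_ext f p \<in> S"
  unfolding lin_ext_def by (intro lin_subspace_sum lin_subspaceD assms)

lemma lin_ext_lin_ext: "lin_ext f (lin_ext g p) = lin_ext (\<lambda>a. lin_ext f (g a)) p"
  unfolding lin_ext_def[of _ p] by (simp add: lin_ext_sum lin_ext_scale)

lemma lin_ext_fun_add: "lin_ext (\<lambda>a. f a + g a) p = lin_ext f p + lin_ext g p"
  by (simp add: lin_ext_def scale_add_right sum.distrib)

lemma lin_ext_fun_scale: "lin_ext (\<lambda>a. scale c (f a)) p = scale c (lin_ext f p)"
  by (simp add: lin_ext_def scale_sum mult.commute)

text \<open>Interchange of two finite sums. It brings the right factor of a product to the outside,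
  for commutativity of monoid algebras and for stability of the tensor kernel under multiplication
  from the right.\<close>

lemma lin_ext_swap: "lin_ext (\<lambda>a. lin_ext (f a) r) p = lin_ext (\<lambda>b. lin_ext (\<lambda>a. f a b) p) r"
  unfolding lin_ext_def by (simp add: scale_sum mult.commute) (rule sum.swap)

lemma lin_ext_basis [simp]: "lin_ext (\<lambda>a. Poly_Mapping.single a 1) p = p"
proof (rule poly_mapping_eqI)
  fix k
  show "Poly_Mapping.lookup (lin_ext (\<lambda>a. Poly_Mapping.single a 1) p) k = Poly_Mapping.lookup p k"
    by (simp add: lin_ext_def lookup_sum lookup_single when_def sum.delta in_keys_iff)
qed


section \<open>Algebras\<close>

lemma complex_ring_simps [simp]:
  "carrier complex_ring = UNIV" "a \<otimes>\<^bsub>complex_ring\<^esub> b = a * b" "a \<oplus>\<^bsub>complex_ring\<^esub> b = a + b"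
  "\<zero>\<^bsub>complex_ring\<^esub> = 0" "\<one>\<^bsub>complex_ring\<^esub> = 1"
  by (simp_all add: complex_ring_def)

lemma cring_complex_ring: "cring complex_ring"
proof (rule cringI)
  show "abelian_group complex_ring"
  proof (rule abelian_groupI)
    show "\<exists>y\<in>carrier complex_ring. y \<oplus>\<^bsub>complex_ring\<^esub> x = \<zero>\<^bsub>complex_ring\<^esub>" for x
      by (rule bexI[of _ "- x"]) simp_all
  qed (simp_all add: algebra_simps)
qed (auto intro: comm_monoidI simp: algebra_simps)

text \<open>The algebra \<open>SLq\<close> is in general noncommutative, so compatibility of scalars
  with the product is required in each factor separately.\<close>

locale complex_algebra = A?: ring A + module complex_ring A for A :: "'a calg" (structure) +
  assumes smult_mult_left:
      "x \<in> carrier A \<Longrightarrow> y \<in> carrier A \<Longrightarrow> (c \<odot> x) \<otimes> y = c \<odot> (x \<otimes> y)"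
    and smult_mult_right:
      "x \<in> carrier A \<Longrightarrow> y \<in> carrier A \<Longrightarrow> x \<otimes> (c \<odot> y) = c \<odot> (x \<otimes> y)"

lemma complex_algebraI:
  assumes "ring A"
    and "\<And>c x. x \<in> carrier A \<Longrightarrow> c \<odot>\<^bsub>A\<^esub> x \<in> carrier A"
    and "\<And>c d x. x \<in> carrier A \<Longrightarrow> (c + d) \<odot>\<^bsub>A\<^esub> x = c \<odot>\<^bsub>A\<^esub> x \<oplus>\<^bsub>A\<^esub> d \<odot>\<^bsub>A\<^esub> x"
    and "\<And>c x y. x \<in> carrier A \<Longrightarrow> y \<in> carrier A \<Longrightarrow>
           c \<odot>\<^bsub>A\<^esub> (x \<oplus>\<^bsub>A\<^esub> y) = c \<odot>\<^bsub>A\<^esub> x \<oplus>\<^bsub>A\<^esub> c \<odot>\<^bsub>A\<^esub> y"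
    and "\<And>c d x. x \<in> carrier A \<Longrightarrow> (c * d) \<odot>\<^bsub>A\<^esub> x = c \<odot>\<^bsub>A\<^esub> (d \<odot>\<^bsub>A\<^esub> x)"
    and "\<And>x. x \<in> carrier A \<Longrightarrow> 1 \<odot>\<^bsub>A\<^esub> x = x"
    and "\<And>c x y. x \<in> carrier A \<Longrightarrow> y \<in> carrier A \<Longrightarrow>
           (c \<odot>\<^bsub>A\<^esub> x) \<otimes>\<^bsub>A\<^esub> y = c \<odot>\<^bsub>A\<^esub> (x \<otimes>\<^bsub>A\<^esub> y)"
    and "\<And>c x y. x \<in> carrier A \<Longrightarrow> y \<in> carrier A \<Longrightarrow>
           x \<otimes>\<^bsub>A\<^esub> (c \<odot>\<^bsub>A\<^esub> y) = c \<odot>\<^bsub>A\<^esub> (x \<otimes>\<^bsub>A\<^esub> y)"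
  shows "complex_algebra A"
  by (intro complex_algebra.intro complex_algebra_axioms.intro moduleI cring_complex_ring
        ring.is_abelian_group) (simp_all add: assms)

lemma (in complex_algebra) submoduleI':
  assumes "H \<subseteq> carrier A" "\<zero> \<in> H" "\<And>x y. x \<in> H \<Longrightarrow> y \<in> H \<Longrightarrow> x \<oplus> y \<in> H"
    and "\<And>c x. x \<in> H \<Longrightarrow> c \<odot> x \<in> H"
  shows "submodule H complex_ring A"
proof (rule submoduleI)
  fix x assume "x \<in> H"
  with assms(1) have "\<ominus> x = (\<ominus>\<^bsub>complex_ring\<^esub> 1) \<odot> x"
    using smult_l_minus[of 1 x] smult_one by auto
  then show "\<ominus> x \<in> H"
    using assms(4) \<open>x \<in> H\<close> by simp
qed (use assms in auto)

text \<open>A ring ideal absorbs scalars because a scalar acts as multiplication by a multiple of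
  the unit. This is what lets scalar multiplication descend to ring quotients.\<close>

lemma (in complex_algebra) ideal_smult_closed:
  assumes "ideal I A" "x \<in> I"
  shows "c \<odot> x \<in> I"
proof -
  interpret ideal I A by fact
  have "x \<in> carrier A"
    using assms(2) by (rule a_Hcarr)
  then have "c \<odot> x = (c \<odot> \<one>) \<otimes> x"
    by (simp add: smult_mult_left)
  then show ?thesis
    using assms(2) by (simp add: I_l_closed)
qed

lemma alg_homI:
  assumes "\<And>x. x \<in> carrier A \<Longrightarrow> h x \<in> carrier B"
    and "\<And>x y. x \<in> carrier A \<Longrightarrow> y \<in> carrier A \<Longrightarrow> h (x \<otimes>\<^bsub>A\<^esub> y) = h x \<otimes>\<^bsub>B\<^esub> h y"
    and "\<And>x y. x \<in> carrier A \<Longrightarrow> y \<in> carrier A \<Longrightarrow> h (x \<oplus>\<^bsub>A\<^esub> y) = h x \<oplus>\<^bsub>B\<^esub> h y"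
    and "h \<one>\<^bsub>A\<^esub> = \<one>\<^bsub>B\<^esub>"
    and "\<And>c x. x \<in> carrier A \<Longrightarrow> h (c \<odot>\<^bsub>A\<^esub> x) = c \<odot>\<^bsub>B\<^esub> h x"
  shows "h \<in> alg_hom A B"
  using assms by (auto simp: alg_hom_def intro!: ring_hom_memI)

lemma alg_homD:
  assumes "h \<in> alg_hom A B"
  shows "x \<in> carrier A \<Longrightarrow> h x \<in> carrier B"
    and "x \<in> carrier A \<Longrightarrow> y \<in> carrier A \<Longrightarrow> h (x \<otimes>\<^bsub>A\<^esub> y) = h x \<otimes>\<^bsub>B\<^esub> h y"
    and "x \<in> carrier A \<Longrightarrow> y \<in> carrier A \<Longrightarrow> h (x \<oplus>\<^bsub>A\<^esub> y) = h x \<oplus>\<^bsub>B\<^esub> h y"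
    and "h \<one>\<^bsub>A\<^esub> = \<one>\<^bsub>B\<^esub>"
    and "x \<in> carrier A \<Longrightarrow> h (c \<odot>\<^bsub>A\<^esub> x) = c \<odot>\<^bsub>B\<^esub> h x"
  using assms by (auto simp: alg_hom_def ring_hom_closed ring_hom_mult ring_hom_add ring_hom_one)

lemma alg_hom_id: "id \<in> alg_hom A A"
  by (rule alg_homI) auto

lemma alg_hom_comp:
  assumes "g \<in> alg_hom A B" "h \<in> alg_hom B C"
  shows "h \<circ> g \<in> alg_hom A C"
  by (rule alg_homI) (simp_all add: alg_homD[OF assms(1)] alg_homD[OF assms(2)])

lemma alg_hom_ring_hom_ring:
  assumes "complex_algebra A" "complex_algebra B" "h \<in> alg_hom A B"
  shows "ring_hom_ring A B h"
  using assms by (intro ring_hom_ringI2) (auto simp: complex_algebra_def alg_hom_def)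


section \<open>Monoid algebras\<close>

lemma monoid_algebra_simps [simp]:
  "carrier (monoid_algebra M) = {p. Poly_Mapping.keys p \<subseteq> carrier M}"
  "\<one>\<^bsub>monoid_algebra M\<^esub> = Poly_Mapping.single \<one>\<^bsub>M\<^esub> 1"
  "\<zero>\<^bsub>monoid_algebra M\<^esub> = 0"
  "p \<oplus>\<^bsub>monoid_algebra M\<^esub> r = p + r"
  "c \<odot>\<^bsub>monoid_algebra M\<^esub> p = scale c p"
  by (simp_all add: monoid_algebra_def scale_def)

lemma monoid_algebra_mult:
  "p \<otimes>\<^bsub>monoid_algebra M\<^esub> r =
     lin_ext (\<lambda>a. lin_ext (\<lambda>b. Poly_Mapping.single (a \<otimes>\<^bsub>M\<^esub> b) 1) r) p"
  by (simp add: monoid_algebra_def lin_ext_def scale_sum)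

lemma monoid_algebra_mult_single [simp]:
  "Poly_Mapping.single a c \<otimes>\<^bsub>monoid_algebra M\<^esub> Poly_Mapping.single b d =
     Poly_Mapping.single (a \<otimes>\<^bsub>M\<^esub> b) (c * d)"
  by (simp add: monoid_algebra_mult)

lemma keys_lin_ext:
  assumes "\<And>a. a \<in> Poly_Mapping.keys p \<Longrightarrow> Poly_Mapping.keys (f a) \<subseteq> X"
  shows "Poly_Mapping.keys (lin_ext f p) \<subseteq> X"
  using lin_ext_mem[OF lin_subspace_keys[of X], of p f] assms by auto

lemma complex_algebra_monoid_algebra:
  assumes "Group.monoid M"
  shows "complex_algebra (monoid_algebra M)"
proof -
  interpret Group.monoid M by fact
  have closed: "Poly_Mapping.keys (p \<otimes>\<^bsub>monoid_algebra M\<^esub> r) \<subseteq> carrier M"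
    if "Poly_Mapping.keys p \<subseteq> carrier M" "Poly_Mapping.keys r \<subseteq> carrier M" for p r
    unfolding monoid_algebra_mult by (intro keys_lin_ext) (use that in auto)
  show ?thesis
  proof (rule complex_algebraI)
    show "ring (monoid_algebra M)"
    proof (rule ringI)
      show "abelian_group (monoid_algebra M)"
      proof (rule abelian_groupI)
        show "\<exists>y\<in>carrier (monoid_algebra M). y \<oplus>\<^bsub>monoid_algebra M\<^esub> x = \<zero>\<^bsub>monoid_algebra M\<^esub>"
          if "x \<in> carrier (monoid_algebra M)" for x
          by (rule bexI[of _ "- x"]) (use that in \<open>auto simp: in_keys_iff\<close>)
      qed (auto simp: algebra_simps dest!: subsetD[OF keys_add])
      show "Group.monoid (monoid_algebra M)"
      proof (rule monoidI)
        fix p r s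
        assume *: "p \<in> carrier (monoid_algebra M)" "r \<in> carrier (monoid_algebra M)"
          "s \<in> carrier (monoid_algebra M)"
        show "p \<otimes>\<^bsub>monoid_algebra M\<^esub> r \<otimes>\<^bsub>monoid_algebra M\<^esub> s =
              p \<otimes>\<^bsub>monoid_algebra M\<^esub> (r \<otimes>\<^bsub>monoid_algebra M\<^esub> s)"
          \<comment> \<open>Both bracketings become the same kind of triple linear extension, so
            associativity is only compared on triples of monoid elements.\<close>
          unfolding monoid_algebra_mult lin_ext_lin_ext lin_ext_single scale_one
          by (intro lin_ext_cong) (use * in \<open>auto intro!: arg_cong[where f = "\<lambda>x. Poly_Mapping.single x 1"] m_assoc\<close>)
      next
        fix p assume p: "p \<in> carrier (monoid_algebra M)"
        have "lin_ext (\<lambda>b. Poly_Mapping.single (\<one>\<^bsub>M\<^esub> \<otimes>\<^bsub>M\<^esub> b) 1) p = lin_ext (\<lambda>b. Poly_Mapping.single b 1) p"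
          by (rule lin_ext_cong) (use p in auto)
        then show "\<one>\<^bsub>monoid_algebra M\<^esub> \<otimes>\<^bsub>monoid_algebra M\<^esub> p = p"
          by (simp add: monoid_algebra_mult)
        have "lin_ext (\<lambda>b. Poly_Mapping.single (b \<otimes>\<^bsub>M\<^esub> \<one>\<^bsub>M\<^esub>) 1) p = lin_ext (\<lambda>b. Poly_Mapping.single b 1) p"
          by (rule lin_ext_cong) (use p in auto)
        then show "p \<otimes>\<^bsub>monoid_algebra M\<^esub> \<one>\<^bsub>monoid_algebra M\<^esub> = p"
          by (simp add: monoid_algebra_mult)
      qed (use closed in auto)
    qed (simp_all add: monoid_algebra_mult lin_ext_add lin_ext_fun_add)
    show "c \<odot>\<^bsub>monoid_algebra M\<^esub> p \<in> carrier (monoid_algebra M)" if "p \<in> carrier (monoid_algebra M)" for c p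
      using that keys_scale[of c p] by auto
    next
    fix c x y show "(c \<odot>\<^bsub>monoid_algebra M\<^esub> x) \<otimes>\<^bsub>monoid_algebra M\<^esub> y = c \<odot>\<^bsub>monoid_algebra M\<^esub> (x \<otimes>\<^bsub>monoid_algebra M\<^esub> y)"
      by (simp add: monoid_algebra_mult lin_ext_scale)
  next
    fix c x y show "x \<otimes>\<^bsub>monoid_algebra M\<^esub> (c \<odot>\<^bsub>monoid_algebra M\<^esub> y) = c \<odot>\<^bsub>monoid_algebra M\<^esub> (x \<otimes>\<^bsub>monoid_algebra M\<^esub> y)"
      by (simp only: monoid_algebra_mult monoid_algebra_simps lin_ext_scale lin_ext_fun_scale)
  qed (simp_all add: scale_add_left scale_add_right)
qed

lemma cring_monoid_algebra:
  assumes "Group.comm_monoid M"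
  shows "cring (monoid_algebra M)"
proof -
  interpret M: Group.comm_monoid M by fact
  interpret complex_algebra "monoid_algebra M"
    by (rule complex_algebra_monoid_algebra) unfold_locales
  show ?thesis
  proof (intro cring.intro A.ring_axioms comm_monoid.intro A.monoid_axioms comm_monoid_axioms.intro)
    fix p r assume *: "p \<in> carrier (monoid_algebra M)" "r \<in> carrier (monoid_algebra M)"
    show "p \<otimes>\<^bsub>monoid_algebra M\<^esub> r = r \<otimes>\<^bsub>monoid_algebra M\<^esub> p"
      unfolding monoid_algebra_mult
      by (subst lin_ext_swap, intro lin_ext_cong) (use * in \<open>auto intro!: arg_cong[where f = "\<lambda>x. Poly_Mapping.single x 1"] M.m_comm\<close>)
  qed
qed

text \<open>Functoriality of the monoid algebra. With \<open>map_prod f g\<close> it yields the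
  tensor product of two homomorphisms, with \<open>weight\<close> the passage from polynomials to
  Laurent polynomials.\<close>

lemma alg_hom_monoid_algebra:
  assumes "h \<in> hom M M'" "h \<one>\<^bsub>M\<^esub> = \<one>\<^bsub>M'\<^esub>"
  shows "lin_ext (\<lambda>a. Poly_Mapping.single (h a) 1) \<in> alg_hom (monoid_algebra M) (monoid_algebra M')"
proof (rule alg_homI)
  fix p r assume *: "p \<in> carrier (monoid_algebra M)" "r \<in> carrier (monoid_algebra M)"
  show "lin_ext (\<lambda>a. Poly_Mapping.single (h a) 1) (p \<otimes>\<^bsub>monoid_algebra M\<^esub> r) =
      lin_ext (\<lambda>a. Poly_Mapping.single (h a) 1) p \<otimes>\<^bsub>monoid_algebra M'\<^esub>
      lin_ext (\<lambda>a. Poly_Mapping.single (h a) 1) r"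
    unfolding monoid_algebra_mult lin_ext_lin_ext lin_ext_single scale_one
    by (intro lin_ext_cong) (use * in \<open>auto intro!: arg_cong[where f = "\<lambda>x. Poly_Mapping.single x 1"] hom_mult[OF assms(1)]\<close>)
next
  fix p assume *: "p \<in> carrier (monoid_algebra M)"
  show "lin_ext (\<lambda>a. Poly_Mapping.single (h a) 1) p \<in> carrier (monoid_algebra M')"
    using * keys_lin_ext[of p "\<lambda>a. Poly_Mapping.single (h a) 1" "carrier M'"] assms(1) by (auto simp: hom_def)
qed (simp_all add: lin_ext_add lin_ext_scale assms(2))


section \<open>Quotient algebras\<close>

lemma carrier_quotient_algebra:
  "carrier (quotient_algebra A I) = (\<lambda>x. I +>\<^bsub>A\<^esub> x) ` carrier A"
  by (auto simp: quotient_algebra_def FactRing_simps)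

context complex_algebra
begin

lemmas one_smult [simp] = smult_one[simplified]
  and zero_smult [simp] = smult_l_null[simplified]

text \<open>The scalar multiple in \<open>quotient_algebra\<close> is a union over all
  representatives. The work lies in collapsing it to one coset: two representatives differ by an
  element of \<open>I\<close>, and so do their multiples.\<close>

lemma coset_alg_hom:
  assumes "ideal I A"
  shows "(\<lambda>x. I +> x) \<in> alg_hom A (quotient_algebra A I)"
proof -
  interpret I: ideal I A by fact
  show ?thesis
  proof (rule alg_homI)
    fix c x assume x: "x \<in> carrier A"
    have "I +> (c \<odot> y) = I +> (c \<odot> x)" if y: "y \<in> I +> x" for y
    proof -
      obtain h where h: "h \<in> I" "y = h \<oplus> x"
        using y by (auto simp: a_r_coset_def')
      have "h \<in> carrier A"
        using h(1) by (rule I.a_Hcarr)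
      then have "c \<odot> y = c \<odot> h \<oplus> c \<odot> x"
        using x h by (simp add: smult_r_distr)
      then have "c \<odot> y \<in> I +> (c \<odot> x)"
        using ideal_smult_closed[OF assms h(1)] by (auto simp: a_r_coset_def')
      then show ?thesis
        using I.a_repr_independence'[of "c \<odot> y" "c \<odot> x"] x by simp
    qed
    then have "(\<Union>y\<in>I +> x. I +> (c \<odot> y)) = I +> (c \<odot> x)"
      using I.a_rcos_self[OF x] by blast
    then show "I +> (c \<odot> x) = c \<odot>\<^bsub>quotient_algebra A I\<^esub> (I +> x)"
      by (simp add: quotient_algebra_def)
  qed (simp_all add: carrier_quotient_algebra,
      simp_all add: quotient_algebra_def FactRing_def I.rcoset_mult_add I.a_rcos_sum)
qed

lemma complex_algebra_quotient:
  assumes "ideal I A"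
  shows "complex_algebra (quotient_algebra A I)" (is "complex_algebra ?Q")
proof -
  interpret I: ideal I A by fact
  \<comment> \<open>Read backwards, the homomorphism laws rewrite each operation on cosets as the
    coset of an operation in \<open>A\<close>, so every algebra law is inherited from
    \<open>A\<close>.\<close>
  note Q = alg_homD(2-)[OF coset_alg_hom[OF assms], symmetric]
  have zero: "\<zero>\<^bsub>?Q\<^esub> = I +> \<zero>"
    using I.a_rcos_const[OF I.zero_closed] by (simp add: quotient_algebra_def FactRing_def)
  have ring: "ring ?Q"
  proof (rule ringI)
    show "abelian_group ?Q"
    proof (rule abelian_groupI)
      fix x assume "x \<in> carrier ?Q"
      then obtain a where "a \<in> carrier A" "x = I +> a"
        by (auto simp: carrier_quotient_algebra)
      then show "\<exists>y\<in>carrier ?Q. y \<oplus>\<^bsub>?Q\<^esub> x = \<zero>\<^bsub>?Q\<^esub>"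
        by (intro bexI[of _ "I +> \<ominus> a"]) (simp_all add: Q zero carrier_quotient_algebra A.l_neg)
    qed (auto simp: carrier_quotient_algebra Q zero A.a_ac)
    show "Group.monoid ?Q"
      by (rule monoidI) (auto simp: carrier_quotient_algebra Q A.m_assoc)
  qed (auto simp: carrier_quotient_algebra Q A.l_distr A.r_distr)
  show ?thesis
  proof (rule complex_algebraI[OF ring])
    show "c \<odot>\<^bsub>?Q\<^esub> x \<in> carrier ?Q" if "x \<in> carrier ?Q" for c x
      using that by (auto simp: carrier_quotient_algebra Q)
  next
    fix c d x assume "x \<in> carrier ?Q"
    then show "(c + d) \<odot>\<^bsub>?Q\<^esub> x = c \<odot>\<^bsub>?Q\<^esub> x \<oplus>\<^bsub>?Q\<^esub> d \<odot>\<^bsub>?Q\<^esub> x"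
      by (clarsimp simp: carrier_quotient_algebra Q smult_l_distr[simplified])
  next
    fix c x y assume "x \<in> carrier ?Q" "y \<in> carrier ?Q"
    then show "c \<odot>\<^bsub>?Q\<^esub> (x \<oplus>\<^bsub>?Q\<^esub> y) = c \<odot>\<^bsub>?Q\<^esub> x \<oplus>\<^bsub>?Q\<^esub> c \<odot>\<^bsub>?Q\<^esub> y"
      by (clarsimp simp: carrier_quotient_algebra Q smult_r_distr[simplified])
  next
    fix c d x assume "x \<in> carrier ?Q"
    then show "(c * d) \<odot>\<^bsub>?Q\<^esub> x = c \<odot>\<^bsub>?Q\<^esub> (d \<odot>\<^bsub>?Q\<^esub> x)"
      by (clarsimp simp: carrier_quotient_algebra Q smult_assoc1[simplified])
  next
    fix x assume "x \<in> carrier ?Q"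
    then show "1 \<odot>\<^bsub>?Q\<^esub> x = x"
      by (clarsimp simp: carrier_quotient_algebra Q)
  next
    fix c x y assume "x \<in> carrier ?Q" "y \<in> carrier ?Q"
    then show "(c \<odot>\<^bsub>?Q\<^esub> x) \<otimes>\<^bsub>?Q\<^esub> y = c \<odot>\<^bsub>?Q\<^esub> (x \<otimes>\<^bsub>?Q\<^esub> y)"
      by (clarsimp simp: carrier_quotient_algebra Q smult_mult_left)
  next
    fix c x y assume "x \<in> carrier ?Q" "y \<in> carrier ?Q"
    then show "x \<otimes>\<^bsub>?Q\<^esub> (c \<odot>\<^bsub>?Q\<^esub> y) = c \<odot>\<^bsub>?Q\<^esub> (x \<otimes>\<^bsub>?Q\<^esub> y)"
      by (clarsimp simp: carrier_quotient_algebra Q smult_mult_right)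
  qed
qed

end

section \<open>Cosets in monoid algebras\<close>

lemma coset_monoid_algebra: "I +>\<^bsub>monoid_algebra M\<^esub> p = (\<lambda>h. h + p) ` I"
  by (auto simp: a_r_coset_def')

lemma mem_coset_monoid_algebra: "r \<in> I +>\<^bsub>monoid_algebra M\<^esub> p \<longleftrightarrow> r - p \<in> I"
  by (auto simp: coset_monoid_algebra intro: image_eqI[of _ _ "r - p"])

text \<open>Addition in a monoid algebra is that of the whole type, so equality of cosets is plain
  congruence modulo a subspace, for arbitrary \<open>p\<close> and \<open>r\<close>. Independence of
  chosen representatives is always checked through this criterion.\<close>

lemma coset_monoid_algebra_eq_iff:
  assumes "lin_subspace I"
  shows "I +>\<^bsub>monoid_algebra M\<^esub> p = I +>\<^bsub>monoid_algebra M\<^esub> r \<longleftrightarrow> p - r \<in> I"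
proof
  assume "I +>\<^bsub>monoid_algebra M\<^esub> p = I +>\<^bsub>monoid_algebra M\<^esub> r"
  moreover have "p \<in> I +>\<^bsub>monoid_algebra M\<^esub> p"
    by (simp add: mem_coset_monoid_algebra lin_subspaceD(1)[OF assms])
  ultimately show "p - r \<in> I"
    by (simp add: mem_coset_monoid_algebra)
next
  assume *: "p - r \<in> I"
  have "s - p \<in> I \<longleftrightarrow> s - r \<in> I" for s
    using lin_subspaceD(2)[OF assms _ *, of "s - p"] lin_subspace_diff[OF assms _ *, of "s - r"]
    by auto
  then show "I +>\<^bsub>monoid_algebra M\<^esub> p = I +>\<^bsub>monoid_algebra M\<^esub> r"
    by (auto simp: mem_coset_monoid_algebra)
qed

lemma lin_subspace_submodule:
  assumes "Group.monoid M" "submodule H complex_ring (monoid_algebra M)"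
  shows "lin_subspace H"
proof -
  interpret complex_algebra "monoid_algebra M"
    by (rule complex_algebra_monoid_algebra) fact
  show ?thesis
    using submoduleE[OF assms(2)] submodule.smult_closed[OF assms(2)]
      additive_subgroup.zero_closed[OF additive_subgroupI[OF submodule.axioms(1)[OF assms(2)]]]
    by (auto simp: lin_subspace_def)
qed

lemma lin_subspace_ideal:
  assumes "Group.monoid M" "ideal I (monoid_algebra M)"
  shows "lin_subspace I"
proof -
  interpret complex_algebra "monoid_algebra M"
    by (rule complex_algebra_monoid_algebra) fact
  interpret I: ideal I "monoid_algebra M" by fact
  show ?thesis
    using I.zero_closed I.a_closed ideal_smult_closed[OF assms(2)] by (auto simp: lin_subspace_def)
qed

lemma submodule_lin_subspace:
  assumes "Group.monoid M" "lin_subspace H" "H \<subseteq> carrier (monoid_algebra M)"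
  shows "submodule H complex_ring (monoid_algebra M)"
proof -
  interpret complex_algebra "monoid_algebra M"
    by (rule complex_algebra_monoid_algebra) fact
  show ?thesis
    by (rule submoduleI') (use assms(2,3) in \<open>auto intro: lin_subspaceD\<close>)
qed


lemma keys_diff_subset:
  fixes p r :: "'a \<Rightarrow>\<^sub>0 complex"
  assumes "Poly_Mapping.keys p \<subseteq> X" "Poly_Mapping.keys r \<subseteq> X"
  shows "Poly_Mapping.keys (p - r) \<subseteq> X"
  using lin_subspace_diff[OF lin_subspace_keys[of X], of p r] assms by simp


section \<open>Tensor products\<close>

locale tensor_product = L: complex_algebra A + R: complex_algebra B
  for A :: "'a calg" and B :: "'b calg"
begin

abbreviation "free \<equiv> monoid_algebra (A \<times>\<times> B)"
abbreviation "rel \<equiv> tensor_kernel A B"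
abbreviation basis :: "'a \<Rightarrow> 'b \<Rightarrow> ('a \<times> 'b \<Rightarrow>\<^sub>0 complex)" where
  "basis a b \<equiv> Poly_Mapping.single (a, b) 1"

lemma monoid: "Group.monoid (A \<times>\<times> B)"
  by (intro DirProd_monoid L.A.monoid_axioms R.A.monoid_axioms)

sublocale F: complex_algebra free
  by (rule complex_algebra_monoid_algebra[OF monoid])

lemma relators_subset: "bilinear_relators A B \<subseteq> carrier free"
  unfolding bilinear_relators_def
  by (intro Un_least subsetI; elim CollectE exE conjE; simp; intro keys_diff_subset; simp)

text \<open>The whole carrier is one of the submodules in the intersection that defines the
  kernel.\<close>

lemma kernel_subset: "rel \<subseteq> carrier free"
  unfolding tensor_kernel_def using F.carrier_is_submodule relators_subset by blast

lemma kernel_subspace: "lin_subspace rel"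
proof -
  have "lin_subspace H" if "submodule H complex_ring free" for H
    by (rule lin_subspace_submodule[OF monoid that])
  then show ?thesis
    unfolding tensor_kernel_def lin_subspace_def by simp
qed

lemma relator_in_kernel:
  assumes "a \<in> carrier A" "b \<in> carrier B"
  shows "a' \<in> carrier A \<Longrightarrow> basis (a \<oplus>\<^bsub>A\<^esub> a') b - basis a b - basis a' b \<in> rel"
    and "b' \<in> carrier B \<Longrightarrow> basis a (b \<oplus>\<^bsub>B\<^esub> b') - basis a b - basis a b' \<in> rel"
    and "basis (c \<odot>\<^bsub>A\<^esub> a) b - scale c (basis a b) \<in> rel"
    and "basis a (c \<odot>\<^bsub>B\<^esub> b) - scale c (basis a b) \<in> rel"
proof -
  have "r \<in> bilinear_relators A B \<Longrightarrow> r \<in> rel" for r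
    unfolding tensor_kernel_def by blast
  note * = this[unfolded bilinear_relators_def]
  show "a' \<in> carrier A \<Longrightarrow> basis (a \<oplus>\<^bsub>A\<^esub> a') b - basis a b - basis a' b \<in> rel"
    "b' \<in> carrier B \<Longrightarrow> basis a (b \<oplus>\<^bsub>B\<^esub> b') - basis a b - basis a b' \<in> rel"
    "basis (c \<odot>\<^bsub>A\<^esub> a) b - scale c (basis a b) \<in> rel"
    "basis a (c \<odot>\<^bsub>B\<^esub> b) - scale c (basis a b) \<in> rel"
    by (rule *, use assms in \<open>simp, blast\<close>)+
qed

text \<open>The universal property of the tensor product, for maps that are bilinear only modulo
  \<open>S\<close>: the elements sent into \<open>S\<close> form a submodule containing the
  relators, and the kernel is the least one. Leaving \<open>S\<close> free covers the ideal property
  of the kernel, tensor products of maps, and lifts to quotients.\<close>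

lemma kernel_universal:
  fixes f :: "'a \<times> 'b \<Rightarrow> 'c \<Rightarrow>\<^sub>0 complex"
  assumes S: "lin_subspace S"
    and "\<And>a a' b. a \<in> carrier A \<Longrightarrow> a' \<in> carrier A \<Longrightarrow> b \<in> carrier B \<Longrightarrow>
           f (a \<oplus>\<^bsub>A\<^esub> a', b) - f (a, b) - f (a', b) \<in> S"
    and "\<And>a b b'. a \<in> carrier A \<Longrightarrow> b \<in> carrier B \<Longrightarrow> b' \<in> carrier B \<Longrightarrow>
           f (a, b \<oplus>\<^bsub>B\<^esub> b') - f (a, b) - f (a, b') \<in> S"
    and "\<And>a b c. a \<in> carrier A \<Longrightarrow> b \<in> carrier B \<Longrightarrow> f (c \<odot>\<^bsub>A\<^esub> a, b) - scale c (f (a, b)) \<in> S"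
    and "\<And>a b c. a \<in> carrier A \<Longrightarrow> b \<in> carrier B \<Longrightarrow> f (a, c \<odot>\<^bsub>B\<^esub> b) - scale c (f (a, b)) \<in> S"
    and "p \<in> rel"
  shows "lin_ext f p \<in> S"
proof -
  let ?H = "{p \<in> carrier free. lin_ext f p \<in> S}"
  have "lin_subspace ?H"
    using lin_subspace_keys[of "carrier A \<times> carrier B"] S
    by (simp add: lin_subspace_def lin_ext_add lin_ext_scale)
  then have "submodule ?H complex_ring free"
    by (intro submodule_lin_subspace monoid) auto
  moreover have "bilinear_relators A B \<subseteq> {p. lin_ext f p \<in> S}"
    by (auto simp: bilinear_relators_def lin_ext_diff assms(2-5))
  then have "bilinear_relators A B \<subseteq> ?H"
    using relators_subset by blast
  ultimately show ?thesis
    using \<open>p \<in> rel\<close> unfolding tensor_kernel_def by blast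
qed

lemma kernel_ideal: "ideal rel free"
proof (rule idealI)
  show "ring free"
    by (rule F.A.ring_axioms)
  show "subgroup rel (add_monoid free)"
    using submodule_lin_subspace[OF monoid kernel_subspace kernel_subset] by (rule submodule.axioms)
next
  fix p r assume p: "p \<in> rel" and r: "r \<in> carrier free"
  \<comment> \<open>Multiplication by one fixed pair is bilinear modulo the kernel, by
    distributivity in \<open>A\<close> and \<open>B\<close>. The general factor \<open>r\<close> is
    then a linear combination of such pairs.\<close>
  have "lin_ext (\<lambda>y. Poly_Mapping.single (x \<otimes>\<^bsub>A \<times>\<times> B\<^esub> y) 1) p \<in> rel"
    if "x \<in> carrier (A \<times>\<times> B)" for x
    by (rule kernel_universal[OF kernel_subspace _ _ _ _ p])
      (use that in \<open>auto simp: L.A.r_distr R.A.r_distr L.smult_mult_right R.smult_mult_right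
         simp del: scale_single intro!: relator_in_kernel\<close>)
  then show "r \<otimes>\<^bsub>free\<^esub> p \<in> rel"
    unfolding monoid_algebra_mult by (rule lin_ext_mem[OF kernel_subspace]) (use r in auto)
  have "lin_ext (\<lambda>x. Poly_Mapping.single (x \<otimes>\<^bsub>A \<times>\<times> B\<^esub> y) 1) p \<in> rel"
    if "y \<in> carrier (A \<times>\<times> B)" for y
    by (rule kernel_universal[OF kernel_subspace _ _ _ _ p])
      (use that in \<open>auto simp: L.A.l_distr R.A.l_distr L.smult_mult_left R.smult_mult_left
         simp del: scale_single intro!: relator_in_kernel\<close>)
  then show "p \<otimes>\<^bsub>free\<^esub> r \<in> rel"
    unfolding monoid_algebra_mult
    by (subst lin_ext_swap, rule lin_ext_mem[OF kernel_subspace]) (use r in auto)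
qed

end


section \<open>The tensor algebra and linear maps out of it\<close>

context tensor_product
begin

sublocale T: complex_algebra "tensor_algebra A B"
  unfolding tensor_algebra_def by (rule F.complex_algebra_quotient[OF kernel_ideal])

lemma class_alg_hom: "tensor_class A B \<in> alg_hom free (tensor_algebra A B)"
  unfolding tensor_algebra_def tensor_class_def using F.coset_alg_hom[OF kernel_ideal] .

lemma carrier_tensor: "carrier (tensor_algebra A B) = tensor_class A B ` carrier free"
  by (simp add: tensor_algebra_def tensor_class_def carrier_quotient_algebra)

lemma class_eq_iff: "tensor_class A B p = tensor_class A B r \<longleftrightarrow> p - r \<in> rel"
  unfolding tensor_class_def by (rule coset_monoid_algebra_eq_iff[OF kernel_subspace])

lemma pure_closed [simp]:
  "a \<in> carrier A \<Longrightarrow> b \<in> carrier B \<Longrightarrow> pure_tensor A B a b \<in> carrier (tensor_algebra A B)"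
  by (auto simp: pure_tensor_def carrier_tensor)

lemma pure_mult:
  assumes "a \<in> carrier A" "b \<in> carrier B" "a' \<in> carrier A" "b' \<in> carrier B"
  shows "pure_tensor A B a b \<otimes>\<^bsub>tensor_algebra A B\<^esub> pure_tensor A B a' b' =
    pure_tensor A B (a \<otimes>\<^bsub>A\<^esub> a') (b \<otimes>\<^bsub>B\<^esub> b')"
  using assms by (simp add: pure_tensor_def alg_homD(2)[OF class_alg_hom, symmetric])

lemma pure_one: "pure_tensor A B \<one>\<^bsub>A\<^esub> \<one>\<^bsub>B\<^esub> = \<one>\<^bsub>tensor_algebra A B\<^esub>"
  using alg_homD(4)[OF class_alg_hom] by (simp add: pure_tensor_def)

lemma pure_add_left:
  assumes "a \<in> carrier A" "a' \<in> carrier A" "b \<in> carrier B"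
  shows "pure_tensor A B (a \<oplus>\<^bsub>A\<^esub> a') b =
    pure_tensor A B a b \<oplus>\<^bsub>tensor_algebra A B\<^esub> pure_tensor A B a' b"
  using assms relator_in_kernel(1)[of a b a']
  by (simp add: pure_tensor_def alg_homD(3)[OF class_alg_hom, symmetric] class_eq_iff diff_diff_eq)

lemma pure_add_right:
  assumes "a \<in> carrier A" "b \<in> carrier B" "b' \<in> carrier B"
  shows "pure_tensor A B a (b \<oplus>\<^bsub>B\<^esub> b') =
    pure_tensor A B a b \<oplus>\<^bsub>tensor_algebra A B\<^esub> pure_tensor A B a b'"
  using assms relator_in_kernel(2)[of a b b']
  by (simp add: pure_tensor_def alg_homD(3)[OF class_alg_hom, symmetric] class_eq_iff diff_diff_eq)

lemma pure_smult_left: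
  assumes "a \<in> carrier A" "b \<in> carrier B"
  shows "pure_tensor A B (c \<odot>\<^bsub>A\<^esub> a) b = c \<odot>\<^bsub>tensor_algebra A B\<^esub> pure_tensor A B a b"
  using assms relator_in_kernel(3)[of a b c]
  by (simp add: pure_tensor_def alg_homD(5)[OF class_alg_hom, symmetric] class_eq_iff)

lemma pure_smult_right:
  assumes "a \<in> carrier A" "b \<in> carrier B"
  shows "pure_tensor A B a (c \<odot>\<^bsub>B\<^esub> b) = c \<odot>\<^bsub>tensor_algebra A B\<^esub> pure_tensor A B a b"
  using assms relator_in_kernel(4)[of a b c]
  by (simp add: pure_tensor_def alg_homD(5)[OF class_alg_hom, symmetric] class_eq_iff)

lemma pure_zero_left:
  assumes "b \<in> carrier B"
  shows "pure_tensor A B \<zero>\<^bsub>A\<^esub> b = \<zero>\<^bsub>tensor_algebra A B\<^esub>"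
  using pure_smult_left[of "\<zero>\<^bsub>A\<^esub>" b 0] assms by simp

lemma pure_zero_right:
  assumes "a \<in> carrier A"
  shows "pure_tensor A B a \<zero>\<^bsub>B\<^esub> = \<zero>\<^bsub>tensor_algebra A B\<^esub>"
  using pure_smult_right[of a "\<zero>\<^bsub>B\<^esub>" 0] assms by simp

text \<open>The linear map on \<open>A \<otimes> B\<close> induced by a bilinear map \<open>f\<close>. Coset representatives are chosen
  arbitrarily, so the induced map is computed in the free vector space up to elements of \<open>I\<close>.\<close>

lemma tensor_lift:
  fixes f :: "'a \<Rightarrow> 'b \<Rightarrow> ('m \<Rightarrow>\<^sub>0 complex) set" and M :: "('m, 'z) monoid_scheme" and I
  defines "V \<equiv> quotient_algebra (monoid_algebra M) I"
  assumes M: "Group.monoid M" and I: "ideal I (monoid_algebra M)"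
    and f_closed: "\<And>a b. a \<in> carrier A \<Longrightarrow> b \<in> carrier B \<Longrightarrow> f a b \<in> carrier V"
    and f_add: "\<And>a a' b. a \<in> carrier A \<Longrightarrow> a' \<in> carrier A \<Longrightarrow> b \<in> carrier B \<Longrightarrow>
           f (a \<oplus>\<^bsub>A\<^esub> a') b = f a b \<oplus>\<^bsub>V\<^esub> f a' b"
      "\<And>a b b'. a \<in> carrier A \<Longrightarrow> b \<in> carrier B \<Longrightarrow> b' \<in> carrier B \<Longrightarrow>
           f a (b \<oplus>\<^bsub>B\<^esub> b') = f a b \<oplus>\<^bsub>V\<^esub> f a b'"
    and f_smult: "\<And>a b c. a \<in> carrier A \<Longrightarrow> b \<in> carrier B \<Longrightarrow> f (c \<odot>\<^bsub>A\<^esub> a) b = c \<odot>\<^bsub>V\<^esub> f a b"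
      "\<And>a b c. a \<in> carrier A \<Longrightarrow> b \<in> carrier B \<Longrightarrow> f a (c \<odot>\<^bsub>B\<^esub> b) = c \<odot>\<^bsub>V\<^esub> f a b"
  obtains h where "\<And>x. x \<in> carrier (tensor_algebra A B) \<Longrightarrow> h x \<in> carrier V"
    and "\<And>x y. x \<in> carrier (tensor_algebra A B) \<Longrightarrow> y \<in> carrier (tensor_algebra A B) \<Longrightarrow>
           h (x \<oplus>\<^bsub>tensor_algebra A B\<^esub> y) = h x \<oplus>\<^bsub>V\<^esub> h y"
    and "\<And>a b. a \<in> carrier A \<Longrightarrow> b \<in> carrier B \<Longrightarrow> h (pure_tensor A B a b) = f a b"
proof -
  interpret M: complex_algebra "monoid_algebra M"
    by (rule complex_algebra_monoid_algebra[OF M])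
  have sub: "lin_subspace I"
    by (rule lin_subspace_ideal[OF M I])
  define cls where "cls = (\<lambda>p. I +>\<^bsub>monoid_algebra M\<^esub> p)"
  have cls_hom: "cls \<in> alg_hom (monoid_algebra M) V"
    unfolding cls_def V_def by (rule M.coset_alg_hom[OF I])
  have cls_eq: "cls p = cls r \<longleftrightarrow> p - r \<in> I" for p r
    unfolding cls_def by (rule coset_monoid_algebra_eq_iff[OF sub])
  have "\<exists>p. p \<in> carrier (monoid_algebra M) \<and> cls p = f a b" if "a \<in> carrier A" "b \<in> carrier B" for a b
    using f_closed[OF that] by (auto simp: V_def carrier_quotient_algebra cls_def)
  then have "\<forall>x\<in>carrier A \<times> carrier B. \<exists>p. p \<in> carrier (monoid_algebra M) \<and> cls p = f (fst x) (snd x)"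
    by auto
  then obtain g where "\<forall>x\<in>carrier A \<times> carrier B. g x \<in> carrier (monoid_algebra M) \<and> cls (g x) = f (fst x) (snd x)"
    by (rule bchoice[THEN exE])
  then have g:
      "\<And>a b. a \<in> carrier A \<Longrightarrow> b \<in> carrier B \<Longrightarrow> g (a, b) \<in> carrier (monoid_algebra M)"
      "\<And>a b. a \<in> carrier A \<Longrightarrow> b \<in> carrier B \<Longrightarrow> cls (g (a, b)) = f a b"
    by auto
  note cls_add = alg_homD(3)[OF cls_hom, simplified] and cls_scale = alg_homD(5)[OF cls_hom, simplified]
  note g' = g(1)[simplified]
  \<comment> \<open>The chosen \<open>g\<close> need not be bilinear. It represents the bilinear
    \<open>f\<close>, so each defect of bilinearity lies in \<open>I\<close>.\<close>
  have ker: "lin_ext g p \<in> I" if "p \<in> rel" for p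
  proof (rule kernel_universal[OF sub _ _ _ _ that])
    fix a a' b assume "a \<in> carrier A" "a' \<in> carrier A" "b \<in> carrier B"
    then show "g (a \<oplus>\<^bsub>A\<^esub> a', b) - g (a, b) - g (a', b) \<in> I"
      unfolding diff_diff_eq by (simp add: cls_eq[symmetric] g cls_add g' f_add)
  next
    fix a b b' assume "a \<in> carrier A" "b \<in> carrier B" "b' \<in> carrier B"
    then show "g (a, b \<oplus>\<^bsub>B\<^esub> b') - g (a, b) - g (a, b') \<in> I"
      unfolding diff_diff_eq by (simp add: cls_eq[symmetric] g cls_add g' f_add)
  next
    fix a b c assume "a \<in> carrier A" "b \<in> carrier B"
    then show "g (c \<odot>\<^bsub>A\<^esub> a, b) - scale c (g (a, b)) \<in> I" "g (a, c \<odot>\<^bsub>B\<^esub> b) - scale c (g (a, b)) \<in> I"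
      by (simp_all add: cls_eq[symmetric] g cls_scale g' f_smult)
  qed
  define h where "h x = cls (lin_ext g (SOME p. p \<in> carrier free \<and> tensor_class A B p = x))" for x
  have h: "h (tensor_class A B p) = cls (lin_ext g p)" if "p \<in> carrier free" for p
  proof -
    \<comment> \<open>The representative picked by \<open>h\<close> may differ from
      \<open>p\<close>, but only by an element of the tensor kernel, which \<open>lin_ext g\<close>
      maps into \<open>I\<close>.\<close>
    let ?r = "SOME r. r \<in> carrier free \<and> tensor_class A B r = tensor_class A B p"
    have "?r \<in> carrier free \<and> tensor_class A B ?r = tensor_class A B p"
      by (rule someI[of _ p]) (use that in simp)
    then have "lin_ext g (?r - p) \<in> I"
      by (intro ker) (simp add: class_eq_iff)
    then show ?thesis
      by (simp add: h_def cls_eq lin_ext_diff)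
  qed
  have lin_ext_closed: "lin_ext g p \<in> carrier (monoid_algebra M)" if "p \<in> carrier free" for p
    using keys_lin_ext[of p g "carrier M"] that g' by auto
  show thesis
  proof (rule that[of h])
    fix x assume "x \<in> carrier (tensor_algebra A B)"
    then show "h x \<in> carrier V"
      using alg_homD(1)[OF cls_hom lin_ext_closed] by (auto simp: carrier_tensor h)
  next
    fix x y assume "x \<in> carrier (tensor_algebra A B)" "y \<in> carrier (tensor_algebra A B)"
    then obtain p r where p: "p \<in> carrier free" "r \<in> carrier free"
      and "x = tensor_class A B p" "y = tensor_class A B r"
      by (auto simp: carrier_tensor)
    then have *: "x \<oplus>\<^bsub>tensor_algebra A B\<^esub> y = tensor_class A B (p + r)"
      by (simp add: alg_homD(3)[OF class_alg_hom, symmetric])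
    have "p + r \<in> carrier free"
      using F.A.add.m_closed[OF p] by simp
    with * p \<open>x = _\<close> \<open>y = _\<close> show "h (x \<oplus>\<^bsub>tensor_algebra A B\<^esub> y) = h x \<oplus>\<^bsub>V\<^esub> h y"
      using lin_ext_closed[OF p(1)] lin_ext_closed[OF p(2)] by (simp add: h lin_ext_add cls_add)
  next
    fix a b assume "a \<in> carrier A" "b \<in> carrier B"
    then show "h (pure_tensor A B a b) = f a b"
      by (simp add: pure_tensor_def h g)
  qed
qed

end

text \<open>On pairs, \<open>map_prod f g\<close> is a homomorphism of product monoids, so its
  linear extension \<open>?P\<close> is already multiplicative before passing to the quotient. What
  remains is that \<open>?P\<close> carries one tensor kernel into the other.\<close>

lemma alg_hom_tensor_map:
  assumes "complex_algebra A" "complex_algebra B" "complex_algebra C" "complex_algebra D"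
    and f: "f \<in> alg_hom A C" and g: "g \<in> alg_hom B D"
  shows "tensor_map C D f g \<in> alg_hom (tensor_algebra A B) (tensor_algebra C D)"
    and "a \<in> carrier A \<Longrightarrow> b \<in> carrier B \<Longrightarrow>
      tensor_map C D f g (pure_tensor A B a b) = pure_tensor C D (f a) (g b)"
proof -
  interpret AB: tensor_product A B
    by (intro tensor_product.intro assms)
  interpret CD: tensor_product C D
    by (intro tensor_product.intro assms)
  let ?P = "lin_ext (\<lambda>x. Poly_Mapping.single (map_prod f g x) 1)"
  have P: "?P \<in> alg_hom AB.free CD.free"
  proof (rule alg_hom_monoid_algebra)
    show "map_prod f g \<in> hom (A \<times>\<times> B) (C \<times>\<times> D)"
      by (auto simp: hom_def alg_homD[OF f] alg_homD[OF g])
  qed (simp add: alg_homD[OF f] alg_homD[OF g])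
  have ker: "?P p \<in> CD.rel" if "p \<in> AB.rel" for p
    by (rule AB.kernel_universal[OF CD.kernel_subspace _ _ _ _ that])
      (auto simp: alg_homD[OF f] alg_homD[OF g] simp del: scale_single intro!: CD.relator_in_kernel)
  have push: "tensor_map C D f g (tensor_class A B p) = tensor_class C D (?P p)" for p
  proof -
    have eq: "(\<Sum>(a, b)\<in>Poly_Mapping.keys r. Poly_Mapping.single (f a, g b) (Poly_Mapping.lookup r (a, b))) = ?P r" for r
      by (simp add: lin_ext_def case_prod_beta map_prod_def)
    \<comment> \<open>All members of the union in \<open>tensor_map\<close> are this one coset, so
      any representative may be used to evaluate it.\<close>
    have const: "tensor_class C D (?P r) = tensor_class C D (?P p)" if "r \<in> tensor_class A B p" for r
      unfolding CD.class_eq_iff lin_ext_diff[symmetric]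
      by (rule ker) (use that in \<open>simp add: tensor_class_def mem_coset_monoid_algebra\<close>)
    have self: "p \<in> tensor_class A B p"
      using lin_subspaceD(1)[OF AB.kernel_subspace] by (simp add: tensor_class_def mem_coset_monoid_algebra)
    show ?thesis
      unfolding tensor_map_def eq using const by (intro UN_constant_eq[OF self] ballI)
  qed
  show "tensor_map C D f g \<in> alg_hom (tensor_algebra A B) (tensor_algebra C D)"
  proof (rule alg_homI, unfold AB.carrier_tensor, goal_cases)
    case (1 x)
    then obtain p where "x = tensor_class A B p" "p \<in> carrier AB.free"
      by (rule imageE)
    then show ?case
      using alg_homD(1)[OF CD.class_alg_hom alg_homD(1)[OF P]] by (simp only: push)
  next
    case (2 x y)
    then show ?case
      by (elim imageE) (simp only: push alg_homD[OF P] AB.F.A.m_closed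
          alg_homD(2)[OF AB.class_alg_hom, symmetric] alg_homD(2)[OF CD.class_alg_hom, symmetric])
  next
    case (3 x y)
    then show ?case
      by (elim imageE) (simp only: push alg_homD[OF P] AB.F.A.a_closed
          alg_homD(3)[OF AB.class_alg_hom, symmetric] alg_homD(3)[OF CD.class_alg_hom, symmetric])
  next
    case 4
    show ?case
      by (simp only: push alg_homD(4)[OF P]
          alg_homD(4)[OF AB.class_alg_hom, symmetric] alg_homD(4)[OF CD.class_alg_hom, symmetric])
  next
    case (5 c x)
    then show ?case
      by (elim imageE) (simp only: push alg_homD[OF P]
          alg_homD(5)[OF AB.class_alg_hom, symmetric] alg_homD(5)[OF CD.class_alg_hom, symmetric])
  qed
  show "tensor_map C D f g (pure_tensor A B a b) = pure_tensor C D (f a) (g b)"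
    by (simp add: pure_tensor_def push)
qed


section \<open>The torus\<close>

lemma (in complex_algebra) cring_quotient:
  assumes "cring A" "ideal I A"
  shows "cring (quotient_algebra A I)"
proof -
  interpret cring A by fact
  interpret Q: complex_algebra "quotient_algebra A I"
    by (rule complex_algebra_quotient) fact
  show ?thesis
  proof (intro cring.intro comm_monoid.intro comm_monoid_axioms.intro Q.A.ring_axioms Q.A.monoid_axioms)
    fix x y assume "x \<in> carrier (quotient_algebra A I)" "y \<in> carrier (quotient_algebra A I)"
    then show "x \<otimes>\<^bsub>quotient_algebra A I\<^esub> y = y \<otimes>\<^bsub>quotient_algebra A I\<^esub> x"
      unfolding carrier_quotient_algebra
      by (elim imageE) (simp add: alg_homD(2)[OF coset_alg_hom[OF assms(2)], symmetric] m_comm)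
  qed
qed

lemma comm_monoid_free_comm_monoid: "Group.comm_monoid (free_comm_monoid X)"
  by (rule comm_monoidI) (auto simp: free_comm_monoid_def algebra_simps dest!: subsetD[OF keys_add])

section \<open>Weights of exponent vectors\<close>

definition weight :: "nat \<Rightarrow> (nat \<Rightarrow>\<^sub>0 nat) \<Rightarrow> nat \<Rightarrow> int" where
  "weight N m = (\<lambda>i\<in>{1..<N}. int (Poly_Mapping.lookup m i) - int (Poly_Mapping.lookup m N))"

text \<open>The additive group Z^(N-1), on extensional functions to match \<open>weights\<close>.
  Its monoid algebra is the Laurent polynomial algebra in N-1 variables.\<close>

definition weight_monoid :: "nat \<Rightarrow> (nat \<Rightarrow> int) monoid" where
  "weight_monoid N =
     \<lparr>carrier = weights N, mult = (\<lambda>\<alpha> \<beta>. \<lambda>i\<in>{1..<N}. \<alpha> i + \<beta> i), one = (\<lambda>i\<in>{1..<N}. 0)\<rparr>"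

lemma weight_in_weights: "weight N m \<in> weights N"
  by (simp add: weight_def weights_def)

lemma monoid_weight_monoid: "Group.monoid (weight_monoid N)"
  by (rule monoidI)
    (auto simp: weight_monoid_def weights_def PiE_UNIV_domain PiE_iff extensional_def
      intro!: restrict_ext ext)

lemma weight_hom: "weight N \<in> hom (free_comm_monoid X) (weight_monoid N)"
proof (rule homI)
  show "weight N m \<in> carrier (weight_monoid N)" for m
    by (simp add: weight_monoid_def weight_in_weights)
  show "weight N (m \<otimes>\<^bsub>free_comm_monoid X\<^esub> m') = weight N m \<otimes>\<^bsub>weight_monoid N\<^esub> weight N m'" for m m'
    by (simp add: weight_monoid_def free_comm_monoid_def weight_def lookup_add fun_eq_iff)
qed

lemma weight_zero: "weight N 0 = \<one>\<^bsub>weight_monoid N\<^esub>"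
  by (simp add: weight_def weight_monoid_def)

lemma keys_sum_single: "Poly_Mapping.keys (\<Sum>i\<in>S. Poly_Mapping.single i (k i) :: 'a \<Rightarrow>\<^sub>0 nat) \<subseteq> S"
  using keys_sum[of "\<lambda>i. Poly_Mapping.single i (k i)" S] by (auto split: if_splits)

lemma lookup_sum_single:
  "finite S \<Longrightarrow> Poly_Mapping.lookup (\<Sum>i\<in>S. Poly_Mapping.single i (k i) :: 'a \<Rightarrow>\<^sub>0 nat) j =
     (if j \<in> S then k j else 0)"
  by (simp add: lookup_sum lookup_single when_def)

text \<open>Adding a constant to all N exponents leaves the weight unchanged, so negative exponents
  can be cleared. Thus each Laurent monomial comes from an ordinary one.\<close>

lemma weight_surj:
  assumes "1 \<le> N" "\<gamma> \<in> weights N"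
  obtains m where "Poly_Mapping.keys m \<subseteq> {1..N}" "weight N m = \<gamma>"
proof
  \<comment> \<open>Any bound on all absolute values of \<open>\<gamma>\<close> would do; the sum of
    absolute values is one. The exponent at \<open>N\<close> is \<open>t\<close> itself, so the
    shift cancels in the weight.\<close>
  define t where "t = (\<Sum>i\<in>{1..<N}. \<bar>\<gamma> i\<bar>)"
  define k where "k = (\<lambda>i. if i = N then nat t else nat (\<gamma> i + t))"
  let ?m = "\<Sum>i\<in>{1..N}. Poly_Mapping.single i (k i)"
  show "Poly_Mapping.keys ?m \<subseteq> {1..N}"
    by (rule keys_sum_single)
  have "0 \<le> t"
    by (simp add: t_def sum_nonneg)
  moreover have "0 \<le> \<gamma> i + t" if "i \<in> {1..<N}" for i
    using member_le_sum[OF that, of "\<lambda>i. \<bar>\<gamma> i\<bar>"] unfolding t_def by auto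
  ultimately have diff: "int (k i) - int (k N) = \<gamma> i" if "i \<in> {1..<N}" for i
    using that by (auto simp: k_def)
  show "weight N ?m = \<gamma>"
  proof
    fix i
    show "weight N ?m i = \<gamma> i"
    proof (cases "i \<in> {1..<N}")
      case True
      with diff[OF True] assms(1) show ?thesis
        by (simp add: weight_def lookup_sum_single)
    next
      case False
      with PiE_arb[OF assms(2)[unfolded weights_def] False] show ?thesis
        by (simp only: weight_def restrict_def if_False)
    qed
  qed
qed

lemma ideal_torus_ideal: "ideal (torus_ideal N) (monoid_algebra (free_comm_monoid {1..N}))"
proof -
  interpret complex_algebra "monoid_algebra (free_comm_monoid {1..N})"
    by (intro complex_algebra_monoid_algebra comm_monoid.axioms(1) comm_monoid_free_comm_monoid)
  show ?thesis
    unfolding torus_ideal_def polynomial_algebra_def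
  proof (rule A.genideal_ideal)
    let ?s = "\<Sum>j\<in>{1..N}. Poly_Mapping.single j (1 :: nat)"
    have "Poly_Mapping.keys (Poly_Mapping.single ?s (1 :: complex) - Poly_Mapping.single 0 1)
        \<subseteq> {m. Poly_Mapping.keys m \<subseteq> {1..N}}"
      by (rule keys_diff_subset) (use keys_sum_single[of "\<lambda>_. 1" "{1..N}"] in simp_all)
    then show "{Poly_Mapping.single ?s 1 - Poly_Mapping.single 0 1}
        \<subseteq> carrier (monoid_algebra (free_comm_monoid {1..N}))"
      by (simp add: free_comm_monoid_def)
  qed
qed

section \<open>Integer powers of invertible elements\<close>

lemma (in Group.monoid) Units_nat_pow_closed: "x \<in> Units G \<Longrightarrow> x [^] (n :: nat) \<in> Units G"
  by (induction n) (simp_all add: Units_m_closed)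

lemma (in Group.monoid) Units_int_pow_closed: "x \<in> Units G \<Longrightarrow> x [^] (k :: int) \<in> carrier G"
  using Units_nat_pow_closed[of x "nat (- k)"] Units_closed[OF Units_nat_pow_closed[of x "nat k"]]
  by (simp add: int_pow_def nat_pow_def Let_def)

text \<open>The link between \<open>torus_monom\<close>, with integer exponents, and monomials of
  the polynomial ring, with natural ones. For \<open>a < b\<close> the first factor is an inverse
  power, hence the assumption that \<open>x\<close> is a unit.\<close>

lemma int_pow_diff_mult:
  assumes "Group.monoid G" "x \<in> Units G"
  shows "x [^]\<^bsub>G\<^esub> (int a - int b) \<otimes>\<^bsub>G\<^esub> x [^]\<^bsub>G\<^esub> b = x [^]\<^bsub>G\<^esub> a"
proof -
  interpret Group.monoid G by fact
  have x: "x \<in> carrier G"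
    using assms(2) by (rule Units_closed)
  show ?thesis
  proof (cases "b \<le> a")
    case True
    then have "int a - int b = int (a - b)"
      by simp
    then have "x [^]\<^bsub>G\<^esub> (int a - int b) = x [^]\<^bsub>G\<^esub> (a - b)"
      by (simp only: int_pow_int)
    then show ?thesis
      using True x by (simp add: nat_pow_mult)
  next
    case False
    define d where "d = b - a"
    have b: "b = d + a" and d: "int a - int b = - int d" "d > 0"
      using False by (simp_all add: d_def)
    have u: "x [^]\<^bsub>G\<^esub> d \<in> Units G"
      using assms(2) by (rule Units_nat_pow_closed)
    have "x [^]\<^bsub>G\<^esub> (int a - int b) = inv\<^bsub>G\<^esub> (x [^]\<^bsub>G\<^esub> d)"
      unfolding d(1) using d(2) by (simp add: int_pow_def nat_pow_def)
    moreover have "x [^]\<^bsub>G\<^esub> b = x [^]\<^bsub>G\<^esub> d \<otimes>\<^bsub>G\<^esub> x [^]\<^bsub>G\<^esub> a"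
      using x by (simp add: b nat_pow_mult)
    ultimately show ?thesis
      using u x by (simp add: m_assoc[symmetric])
  qed
qed

section \<open>Monomials and coefficients in the torus algebra\<close>

definition torus_class :: "nat \<Rightarrow> ((nat \<Rightarrow>\<^sub>0 nat) \<Rightarrow>\<^sub>0 complex) \<Rightarrow> torus" where
  "torus_class N p = torus_ideal N +>\<^bsub>monoid_algebra (free_comm_monoid {1..N})\<^esub> p"

locale torus =
  fixes N :: nat
  assumes N: "1 \<le> N"
begin

abbreviation "Pol \<equiv> monoid_algebra (free_comm_monoid {1..N})"
abbreviation "K \<equiv> Torus N"
abbreviation mon :: "(nat \<Rightarrow>\<^sub>0 nat) \<Rightarrow> torus" where
  "mon m \<equiv> torus_class N (Poly_Mapping.single m 1)"

sublocale Pol: complex_algebra Pol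
  by (intro complex_algebra_monoid_algebra comm_monoid.axioms(1) comm_monoid_free_comm_monoid)

lemma Torus_eq: "K = quotient_algebra Pol (torus_ideal N)"
  by (simp add: Torus_def polynomial_algebra_def)

sublocale K: cring K
  unfolding Torus_eq
  by (intro Pol.cring_quotient ideal_torus_ideal cring_monoid_algebra comm_monoid_free_comm_monoid)

sublocale KC: complex_algebra K
  unfolding Torus_eq by (rule Pol.complex_algebra_quotient[OF ideal_torus_ideal])

lemma class_hom: "torus_class N \<in> alg_hom Pol K"
  unfolding Torus_eq torus_class_def by (rule Pol.coset_alg_hom[OF ideal_torus_ideal])

lemma carrier_K: "carrier K = torus_class N ` carrier Pol"
  by (simp add: Torus_eq carrier_quotient_algebra torus_class_def)

lemma class_eq_iff: "torus_class N p = torus_class N r \<longleftrightarrow> p - r \<in> torus_ideal N"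
  unfolding torus_class_def
  by (intro coset_monoid_algebra_eq_iff lin_subspace_ideal[OF _ ideal_torus_ideal]
      comm_monoid.axioms(1) comm_monoid_free_comm_monoid)

lemma mon_closed: "Poly_Mapping.keys m \<subseteq> {1..N} \<Longrightarrow> mon m \<in> carrier K"
  by (rule alg_homD(1)[OF class_hom]) (simp add: free_comm_monoid_def)

lemma mon_zero: "mon 0 = \<one>\<^bsub>K\<^esub>"
  using alg_homD(4)[OF class_hom] by (simp add: free_comm_monoid_def)

lemma mon_add:
  assumes "Poly_Mapping.keys m \<subseteq> {1..N}" "Poly_Mapping.keys m' \<subseteq> {1..N}"
  shows "mon (m + m') = mon m \<otimes>\<^bsub>K\<^esub> mon m'"
proof -
  have "mon m \<otimes>\<^bsub>K\<^esub> mon m' = torus_class N (Poly_Mapping.single m 1 \<otimes>\<^bsub>Pol\<^esub> Poly_Mapping.single m' 1)"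
    by (rule alg_homD(2)[OF class_hom, symmetric]) (use assms in \<open>simp_all add: free_comm_monoid_def\<close>)
  then show ?thesis
    by (simp add: free_comm_monoid_def)
qed

lemma torus_gen_eq: "torus_gen N i = mon (Poly_Mapping.single i 1)"
  by (simp add: torus_gen_def torus_class_def polynomial_algebra_def)

lemma torus_gen_closed: "i \<in> {1..N} \<Longrightarrow> torus_gen N i \<in> carrier K"
  unfolding torus_gen_eq by (rule mon_closed) simp

lemma mon_single:
  assumes "i \<in> {1..N}"
  shows "mon (Poly_Mapping.single i n) = torus_gen N i [^]\<^bsub>K\<^esub> n"
proof (induction n)
  case 0
  then show ?case by (simp add: mon_zero[simplified])
next
  case (Suc n)
  have "mon (Poly_Mapping.single i (Suc n)) = mon (Poly_Mapping.single i n + Poly_Mapping.single i 1)"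
    by (simp add: single_add[symmetric])
  also have "\<dots> = mon (Poly_Mapping.single i n) \<otimes>\<^bsub>K\<^esub> torus_gen N i"
    unfolding torus_gen_eq by (rule mon_add) (use assms in simp_all)
  finally show ?case
    by (simp add: Suc.IH)
qed

lemma mon_sum:
  assumes "S \<subseteq> {1..N}"
  shows "mon (\<Sum>i\<in>S. Poly_Mapping.single i (k i)) = (\<Otimes>\<^bsub>K\<^esub>i\<in>S. torus_gen N i [^]\<^bsub>K\<^esub> k i)"
  using finite_subset[OF assms finite_atLeastAtMost] assms
proof (induction S)
  case empty
  then show ?case by (simp add: mon_zero[simplified])
next
  case (insert j S)
  have "mon (\<Sum>i\<in>insert j S. Poly_Mapping.single i (k i)) =
      mon (Poly_Mapping.single j (k j)) \<otimes>\<^bsub>K\<^esub> mon (\<Sum>i\<in>S. Poly_Mapping.single i (k i))"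
    unfolding sum.insert[OF insert.hyps]
    by (rule mon_add) (use insert.prems keys_sum_single[of k S] in auto)
  also have "\<dots> = torus_gen N j [^]\<^bsub>K\<^esub> k j \<otimes>\<^bsub>K\<^esub> (\<Otimes>\<^bsub>K\<^esub>i\<in>S. torus_gen N i [^]\<^bsub>K\<^esub> k i)"
    using insert by (simp add: mon_single)
  also have "\<dots> = (\<Otimes>\<^bsub>K\<^esub>i\<in>insert j S. torus_gen N i [^]\<^bsub>K\<^esub> k i)"
    by (rule K.finprod_insert[symmetric])
      (use insert torus_gen_closed in \<open>auto intro!: K.nat_pow_closed\<close>)
  finally show ?case .
qed

text \<open>These are the powers of z_1...z_N, which the single defining relation makes equal to
  1.\<close>

lemma mon_diagonal: "mon (\<Sum>i\<in>{1..N}. Poly_Mapping.single i k) = \<one>\<^bsub>K\<^esub>"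
proof (induction k)
  case 0
  then show ?case by (simp add: mon_zero[simplified])
next
  case (Suc k)
  let ?s = "\<lambda>k. \<Sum>i\<in>{1..N}. Poly_Mapping.single i k"
  \<comment> \<open>The difference of the two monomials is the generator of the ideal.\<close>
  have "mon (?s 1) = mon 0"
    unfolding class_eq_iff torus_ideal_def polynomial_algebra_def
    by (simp add: genideal_def)
  moreover have "?s (Suc k) = ?s k + ?s 1"
    by (simp add: sum.distrib[symmetric] single_add[symmetric])
  then have "mon (?s (Suc k)) = mon (?s k) \<otimes>\<^bsub>K\<^esub> mon (?s 1)"
    by (simp only: mon_add keys_sum_single)
  ultimately show ?case
    using Suc.IH by (simp add: mon_zero[simplified])
qed

text \<open>The defining relation exhibits an inverse: the product \<open>?r\<close> of all the
  other generators. Only with this do the integer powers in \<open>torus_monom\<close> behave as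
  expected.\<close>

lemma torus_gen_unit:
  assumes "i \<in> {1..N}"
  shows "torus_gen N i \<in> Units K"
proof -
  let ?r = "\<Otimes>\<^bsub>K\<^esub>j\<in>{1..N} - {i}. torus_gen N j [^]\<^bsub>K\<^esub> (1 :: nat)"
  have r: "?r \<in> carrier K"
    by (rule K.finprod_closed) (auto intro!: K.nat_pow_closed torus_gen_closed)
  have "\<one>\<^bsub>K\<^esub> = (\<Otimes>\<^bsub>K\<^esub>j\<in>insert i ({1..N} - {i}). torus_gen N j [^]\<^bsub>K\<^esub> (1 :: nat))"
    using mon_sum[of "{1..N}" "\<lambda>_. 1"] mon_diagonal[of 1] assms by (simp add: insert_absorb)
  also have "\<dots> = torus_gen N i [^]\<^bsub>K\<^esub> (1 :: nat) \<otimes>\<^bsub>K\<^esub> ?r"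
    by (rule K.finprod_insert) (use assms torus_gen_closed in \<open>auto intro!: K.nat_pow_closed\<close>)
  finally have "torus_gen N i \<otimes>\<^bsub>K\<^esub> ?r = \<one>\<^bsub>K\<^esub>"
    using torus_gen_closed[OF assms] by simp
  then show ?thesis
    unfolding Units_def using r torus_gen_closed[OF assms] K.m_comm[OF r torus_gen_closed[OF assms]] by auto
qed

lemma torus_monom_closed: "torus_monom N \<gamma> \<in> carrier K"
  unfolding torus_monom_def
proof (rule K.finprod_closed, rule funcsetI)
  fix i assume "i \<in> {1..<N}"
  then have "torus_gen N i \<in> Units K"
    by (intro torus_gen_unit) auto
  then show "torus_gen N i [^]\<^bsub>K\<^esub> \<gamma> i \<in> carrier K"
    by (rule K.Units_int_pow_closed)
qed

text \<open>For i < N the power of z_i splits into its weight part and z_i to the power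
  \<open>k N\<close>. These latter powers join the power of z_N to form (z_1...z_N) to the power
  \<open>k N\<close>, which is 1.\<close>

lemma torus_monom_weight:
  assumes "Poly_Mapping.keys m \<subseteq> {1..N}"
  shows "torus_monom N (weight N m) = mon m"
proof -
  define z where "z = torus_gen N"
  define k where "k = Poly_Mapping.lookup m"
  have z: "z i \<in> carrier K" if "i \<in> {1..N}" for i
    using torus_gen_closed[OF that] by (simp add: z_def)
  \<comment> \<open>Needed for two exponent functions: that of \<open>m\<close>, and the constant
    \<open>k N\<close>.\<close>
  have split: "mon (\<Sum>i\<in>{1..N}. Poly_Mapping.single i (e i)) =
      z N [^]\<^bsub>K\<^esub> e N \<otimes>\<^bsub>K\<^esub> (\<Otimes>\<^bsub>K\<^esub>i\<in>{1..<N}. z i [^]\<^bsub>K\<^esub> e i)" for e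
  proof -
    have "{1..N} = insert N {1..<N}"
      using N by auto
    then have "mon (\<Sum>i\<in>{1..N}. Poly_Mapping.single i (e i)) =
        (\<Otimes>\<^bsub>K\<^esub>i\<in>insert N {1..<N}. z i [^]\<^bsub>K\<^esub> e i)"
      using mon_sum[of "{1..N}" e] by (simp only: z_def)
    also have "\<dots> = z N [^]\<^bsub>K\<^esub> e N \<otimes>\<^bsub>K\<^esub> (\<Otimes>\<^bsub>K\<^esub>i\<in>{1..<N}. z i [^]\<^bsub>K\<^esub> e i)"
      by (rule K.finprod_insert) (use z N in \<open>auto intro!: K.nat_pow_closed\<close>)
    finally show ?thesis .
  qed
  have diff: "z i [^]\<^bsub>K\<^esub> k i = z i [^]\<^bsub>K\<^esub> weight N m i \<otimes>\<^bsub>K\<^esub> z i [^]\<^bsub>K\<^esub> k N" if "i \<in> {1..<N}" for i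
    using that int_pow_diff_mult[OF K.monoid_axioms torus_gen_unit, of i "k i" "k N"]
    by (simp add: weight_def k_def z_def)
  have closed: "z i [^]\<^bsub>K\<^esub> weight N m i \<in> carrier K" if "i \<in> {1..<N}" for i
    using that by (auto simp: z_def intro!: K.Units_int_pow_closed torus_gen_unit)
  let ?d = "\<Otimes>\<^bsub>K\<^esub>i\<in>{1..<N}. z i [^]\<^bsub>K\<^esub> k N"
  have d: "?d \<in> carrier K"
    by (rule K.finprod_closed) (use z in \<open>auto intro!: K.nat_pow_closed\<close>)
  have zN: "z N [^]\<^bsub>K\<^esub> k N \<in> carrier K"
    using z N by (auto intro!: K.nat_pow_closed)
  have "(\<Otimes>\<^bsub>K\<^esub>i\<in>{1..<N}. z i [^]\<^bsub>K\<^esub> k i) = (\<Otimes>\<^bsub>K\<^esub>i\<in>{1..<N}. z i [^]\<^bsub>K\<^esub> weight N m i \<otimes>\<^bsub>K\<^esub> z i [^]\<^bsub>K\<^esub> k N)"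
    by (rule K.finprod_cong') (use diff closed z in \<open>auto intro!: K.m_closed K.nat_pow_closed\<close>)
  also have "\<dots> = torus_monom N (weight N m) \<otimes>\<^bsub>K\<^esub> ?d"
    unfolding torus_monom_def z_def[symmetric]
    by (rule K.finprod_multf) (use z closed in \<open>auto intro!: K.nat_pow_closed\<close>)
  finally have prod: "(\<Otimes>\<^bsub>K\<^esub>i\<in>{1..<N}. z i [^]\<^bsub>K\<^esub> k i) = torus_monom N (weight N m) \<otimes>\<^bsub>K\<^esub> ?d" .
  have "m = (\<Sum>i\<in>{1..N}. Poly_Mapping.single i (k i))"
    using assms by (intro poly_mapping_eqI) (auto simp: lookup_sum_single k_def in_keys_iff subset_iff)
  then have "mon m = z N [^]\<^bsub>K\<^esub> k N \<otimes>\<^bsub>K\<^esub> (torus_monom N (weight N m) \<otimes>\<^bsub>K\<^esub> ?d)"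
    using split[of k] unfolding prod by (simp only:)
  also have "\<dots> = torus_monom N (weight N m) \<otimes>\<^bsub>K\<^esub> (z N [^]\<^bsub>K\<^esub> k N \<otimes>\<^bsub>K\<^esub> ?d)"
    by (rule K.m_lcomm[OF zN torus_monom_closed d])
  also have "z N [^]\<^bsub>K\<^esub> k N \<otimes>\<^bsub>K\<^esub> ?d = \<one>\<^bsub>K\<^esub>"
    using split[of "\<lambda>_. k N"] mon_diagonal[of "k N"] by simp
  finally show ?thesis
    using torus_monom_closed[of "weight N m"] by simp
qed

text \<open>The existence of \<open>e\<close> amounts to independence of z^\<alpha> from the other
  monomials. It is the coefficient at \<open>\<alpha>\<close> of the Laurent polynomial
  \<open>E p\<close>, where \<open>p\<close> is any polynomial representing the given class.\<close>

lemma torus_coefficient: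
  obtains e :: "torus \<Rightarrow> complex" where
    "\<And>x y. x \<in> carrier K \<Longrightarrow> y \<in> carrier K \<Longrightarrow> e (x \<oplus>\<^bsub>K\<^esub> y) = e x + e y"
    "\<And>c x. x \<in> carrier K \<Longrightarrow> e (c \<odot>\<^bsub>K\<^esub> x) = c * e x"
    "\<And>\<gamma>. \<gamma> \<in> weights N \<Longrightarrow> e (torus_monom N \<gamma>) = (if \<gamma> = \<alpha> then 1 else 0)"
proof -
  define E where "E = lin_ext (\<lambda>m. Poly_Mapping.single (weight N m) (1 :: complex))"
  let ?W = "monoid_algebra (weight_monoid N)"
  have E: "E \<in> alg_hom Pol ?W"
    unfolding E_def by (rule alg_hom_monoid_algebra[OF weight_hom]) (simp add: free_comm_monoid_def weight_zero)
  interpret W: complex_algebra ?W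
    by (rule complex_algebra_monoid_algebra[OF monoid_weight_monoid])
  interpret E: ring_hom_ring Pol ?W E
    by (intro alg_hom_ring_hom_ring E Pol.complex_algebra_axioms W.complex_algebra_axioms)
  let ?s = "\<Sum>j\<in>{1..N}. Poly_Mapping.single j (1 :: nat)"
  \<comment> \<open>All N exponents equal 1, so every difference with the N-th one vanishes. Hence
    \<open>E\<close> kills the relator.\<close>
  have "weight N ?s = weight N 0"
    using N by (auto simp: weight_def lookup_sum_single fun_eq_iff restrict_def)
  moreover have "?s \<in> carrier (free_comm_monoid {1..N})"
    using keys_sum_single[of "\<lambda>_. 1" "{1..N}"] by (simp add: free_comm_monoid_def)
  ultimately have "Poly_Mapping.single ?s 1 - Poly_Mapping.single 0 1 \<in> a_kernel Pol ?W E"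
    using keys_diff_subset[of "Poly_Mapping.single ?s 1" "carrier (free_comm_monoid {1..N})" "Poly_Mapping.single 0 1"]
    by (simp add: a_kernel_def' E_def lin_ext_diff free_comm_monoid_def lin_ext_single[of _ 0 1, simplified])
  \<comment> \<open>The kernel of \<open>E\<close> is an ideal, and the ideal generated by the
    relator is the least one containing it.\<close>
  then have sub: "torus_ideal N \<subseteq> a_kernel Pol ?W E"
    unfolding torus_ideal_def polynomial_algebra_def
    by (intro Pol.A.genideal_minimal E.kernel_is_ideal) simp
  have ker: "E p = 0" if "p \<in> torus_ideal N" for p
    using subsetD[OF sub that] by (simp only: a_kernel_def' mem_Collect_eq monoid_algebra_simps)
  define e where
    "e x = Poly_Mapping.lookup (E (SOME p. p \<in> carrier Pol \<and> torus_class N p = x)) \<alpha>" for x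
  have e: "e (torus_class N p) = Poly_Mapping.lookup (E p) \<alpha>" if "p \<in> carrier Pol" for p
  proof -
    let ?r = "SOME r. r \<in> carrier Pol \<and> torus_class N r = torus_class N p"
    have "?r \<in> carrier Pol \<and> torus_class N ?r = torus_class N p"
      by (rule someI[of _ p]) (use that in simp)
    then have "E (?r - p) = 0"
      by (intro ker) (simp add: class_eq_iff)
    then show ?thesis
      by (simp add: e_def E_def lin_ext_diff)
  qed
  show thesis
  proof (rule that[of e])
    fix x y assume "x \<in> carrier K" "y \<in> carrier K"
    then obtain p r where p: "p \<in> carrier Pol" "r \<in> carrier Pol"
      and x: "x = torus_class N p" and y: "y = torus_class N r"
      unfolding carrier_K by (elim imageE)
    have "e (x \<oplus>\<^bsub>K\<^esub> y) = Poly_Mapping.lookup (E (p \<oplus>\<^bsub>Pol\<^esub> r)) \<alpha>"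
      unfolding x y alg_homD(3)[OF class_hom p, symmetric] by (intro e Pol.A.a_closed p)
    then show "e (x \<oplus>\<^bsub>K\<^esub> y) = e x + e y"
      by (simp add: x y e p[simplified] E_def lin_ext_add lookup_add)
  next
    fix c x assume "x \<in> carrier K"
    then obtain p where p: "p \<in> carrier Pol" and x: "x = torus_class N p"
      unfolding carrier_K by (elim imageE)
    have "e (c \<odot>\<^bsub>K\<^esub> x) = Poly_Mapping.lookup (E (c \<odot>\<^bsub>Pol\<^esub> p)) \<alpha>"
      unfolding x alg_homD(5)[OF class_hom p, symmetric] by (intro e Pol.smult_closed p) simp
    then show "e (c \<odot>\<^bsub>K\<^esub> x) = c * e x"
      by (simp add: x e p[simplified] E_def lin_ext_scale)
  next
    fix \<gamma> assume "\<gamma> \<in> weights N"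
    \<comment> \<open>An ordinary monomial representing z^\<gamma> is found first, so that
      \<open>E\<close> can be evaluated on a polynomial without any inverses.\<close>
    then obtain m where m: "Poly_Mapping.keys m \<subseteq> {1..N}" "weight N m = \<gamma>"
      using weight_surj[OF N] by blast
    then have "e (torus_monom N \<gamma>) = Poly_Mapping.lookup (E (Poly_Mapping.single m 1)) \<alpha>"
      using torus_monom_weight[OF m(1)] by (simp add: e free_comm_monoid_def)
    then show "e (torus_monom N \<gamma>) = (if \<gamma> = \<alpha> then 1 else 0)"
      by (simp add: E_def m(2) lookup_single when_def)
  qed
qed

end


section \<open>Direct sums from projections\<close>

text \<open>Applying \<open>\<pi> i\<close> to a decomposition returns its i-th component, which
  gives uniqueness. Existence holds on a set closed under addition and containing every
  \<open>W i\<close>. The hypothesis \<open>span\<close> mentions only zero and addition, because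
  the summands already absorb scalars.\<close>

lemma internal_direct_sumI:
  fixes R :: "('r, 'z) ring_scheme" and V :: "('r, 'a) module" (structure)
  assumes "abelian_monoid V"
    and W: "\<And>i. i \<in> I \<Longrightarrow> submodule (W i) R V"
    and W_subset: "\<And>i. i \<in> I \<Longrightarrow> W i \<subseteq> carrier V"
    and zero: "\<And>i. i \<in> I \<Longrightarrow> \<zero> \<in> W i"
    and W_add: "\<And>i x y. i \<in> I \<Longrightarrow> x \<in> W i \<Longrightarrow> y \<in> W i \<Longrightarrow> x \<oplus> y \<in> W i"
    and closed: "\<And>i x. i \<in> I \<Longrightarrow> x \<in> carrier V \<Longrightarrow> \<pi> i x \<in> carrier V"
    and add: "\<And>i x y. i \<in> I \<Longrightarrow> x \<in> carrier V \<Longrightarrow> y \<in> carrier V \<Longrightarrow> \<pi> i (x \<oplus> y) = \<pi> i x \<oplus> \<pi> i y"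
    and proj: "\<And>i j x. i \<in> I \<Longrightarrow> j \<in> I \<Longrightarrow> x \<in> W j \<Longrightarrow> \<pi> i x = (if i = j then x else \<zero>)"
    and span: "\<And>S. \<zero> \<in> S \<Longrightarrow> (\<And>x y. x \<in> S \<Longrightarrow> y \<in> S \<Longrightarrow> x \<oplus> y \<in> S) \<Longrightarrow>
             (\<And>i. i \<in> I \<Longrightarrow> W i \<subseteq> S) \<Longrightarrow> carrier V \<subseteq> S"
  shows "internal_direct_sum R V I W"
proof -
  interpret abelian_monoid V by fact
  have pi_zero: "\<pi> i \<zero> = \<zero>" if "i \<in> I" for i
    using proj[OF that that zero[OF that]] by simp
  have pi_sum: "\<pi> i (\<Oplus>j\<in>J. f j) = (\<Oplus>j\<in>J. \<pi> i (f j))"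
    if "finite J" "f \<in> J \<rightarrow> carrier V" "i \<in> I" for i J f
    using that
  proof (induction J)
    case (insert j J)
    then have "f j \<in> carrier V" "f \<in> J \<rightarrow> carrier V" "(\<lambda>j. \<pi> i (f j)) \<in> J \<rightarrow> carrier V"
      by (auto intro: closed)
    with insert show ?case
      by (simp add: finsum_insert add closed)
  qed (simp add: pi_zero)
  have unique: "f i = \<pi> i x"
    if f: "f \<in> (\<Pi>\<^sub>E i\<in>I. W i)" and fin: "finite {i \<in> I. f i \<noteq> \<zero>}"
      and x: "x = (\<Oplus>i\<in>{i \<in> I. f i \<noteq> \<zero>}. f i)" and i: "i \<in> I" for f x i
  proof -
    let ?J = "{i \<in> I. f i \<noteq> \<zero>}"
    have fW: "f j \<in> W j" if "j \<in> I" for j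
      using f that by auto
    have fG: "f j \<in> carrier V" if "j \<in> I" for j
      using fW[OF that] W_subset[OF that] by blast
    have "\<pi> i x = (\<Oplus>j\<in>?J. \<pi> i (f j))"
      unfolding x by (rule pi_sum[OF fin _ i]) (use fG in auto)
    also have "\<dots> = (\<Oplus>j\<in>?J. if i = j then f j else \<zero>)"
      by (rule add.finprod_cong') (use fG i proj[OF i _ fW] in auto)
    also have "\<dots> = f i"
    proof (cases "i \<in> ?J")
      case True
      then show ?thesis
        by (rule finsum_singleton[OF _ fin]) (use fG in auto)
    next
      case False
      have "(\<Oplus>j\<in>?J. if i = j then f j else \<zero>) = (\<Oplus>j\<in>?J. \<zero>)"
        by (rule add.finprod_cong') (use False in auto)
      then show ?thesis
        using False i by (simp add: finsum_zero)
    qed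
    finally show ?thesis ..
  qed
  define supp where "supp x = {i \<in> I. \<pi> i x \<noteq> \<zero>}" for x
  \<comment> \<open>The vectors that are recovered from their own finitely many projections;
    \<open>span\<close> is applied to this set.\<close>
  define D where "D = {x \<in> carrier V. (\<forall>i\<in>I. \<pi> i x \<in> W i) \<and> finite (supp x) \<and>
    x = (\<Oplus>i\<in>supp x. \<pi> i x)}"
  have superset: "(\<Oplus>i\<in>supp x. \<pi> i x) = (\<Oplus>i\<in>J. \<pi> i x)"
    if "finite J" "J \<subseteq> I" "supp x \<subseteq> J" "x \<in> carrier V" for x J
    by (rule add.finprod_mono_neutral_cong_left) (use that in \<open>auto simp: supp_def intro: closed\<close>)
  have "carrier V \<subseteq> D"
  proof (rule span)
    show "\<zero> \<in> D"
      by (simp add: D_def supp_def pi_zero zero cong: conj_cong)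
  next
    fix x y assume x: "x \<in> D" and y: "y \<in> D"
    let ?J = "supp x \<union> supp y"
    have G: "x \<in> carrier V" "y \<in> carrier V" and J: "finite ?J" "?J \<subseteq> I"
      using x y by (auto simp: D_def supp_def)
    \<comment> \<open>The inclusion can be strict through cancellation, so the sums are taken over
      the union of both supports and cut down at the end.\<close>
    have sub: "supp (x \<oplus> y) \<subseteq> ?J"
      using G by (auto simp: supp_def add)
    have "x \<oplus> y = (\<Oplus>i\<in>?J. \<pi> i x) \<oplus> (\<Oplus>i\<in>?J. \<pi> i y)"
      using x y superset[OF J _ G(1)] superset[OF J _ G(2)] by (simp add: D_def)
    also have "\<dots> = (\<Oplus>i\<in>?J. \<pi> i x \<oplus> \<pi> i y)"
      by (rule finsum_addf[symmetric]) (use J G in \<open>auto intro: closed\<close>)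
    also have "\<dots> = (\<Oplus>i\<in>?J. \<pi> i (x \<oplus> y))"
      by (rule add.finprod_cong') (use J G in \<open>auto simp: add intro: closed\<close>)
    also have "\<dots> = (\<Oplus>i\<in>supp (x \<oplus> y). \<pi> i (x \<oplus> y))"
      using superset[OF J sub] G by simp
    finally have "x \<oplus> y = (\<Oplus>i\<in>supp (x \<oplus> y). \<pi> i (x \<oplus> y))" .
    moreover have "\<pi> i (x \<oplus> y) \<in> W i" if "i \<in> I" for i
      using x y that by (simp add: D_def add W_add)
    ultimately show "x \<oplus> y \<in> D"
      using G finite_subset[OF sub J(1)] by (simp add: D_def)
  next
    fix j assume j: "j \<in> I"
    show "W j \<subseteq> D"
    proof
      fix x assume x: "x \<in> W j"
      then have G: "x \<in> carrier V"
        using W_subset[OF j] by blast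
      have sub: "supp x \<subseteq> {j}"
        using proj[OF _ j x] by (auto simp: supp_def split: if_splits)
      have "(\<Oplus>i\<in>supp x. \<pi> i x) = x"
        using superset[OF _ _ sub G] j proj[OF j j x] G by simp
      moreover have "\<pi> i x \<in> W i" if "i \<in> I" for i
        using proj[OF that j x] x zero[OF that] by simp
      ultimately show "x \<in> D"
        using G finite_subset[OF sub] by (simp add: D_def)
    qed
  qed
  show ?thesis
    unfolding internal_direct_sum_def
  proof (intro conjI ballI W)
    fix x assume "x \<in> carrier V"
    with \<open>carrier V \<subseteq> D\<close> have x: "x \<in> D"
      by blast
    \<comment> \<open>Families in the extensional product are fixed outside \<open>I\<close>;
      without the restriction uniqueness would fail there.\<close>
    let ?f = "\<lambda>i\<in>I. \<pi> i x"
    have supp: "{i \<in> I. ?f i \<noteq> \<zero>} = supp x"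
      by (auto simp: supp_def)
    have "(\<Oplus>i\<in>supp x. ?f i) = (\<Oplus>i\<in>supp x. \<pi> i x)"
      by (rule add.finprod_cong') (use x in \<open>auto simp: D_def supp_def intro: closed\<close>)
    then have f: "?f \<in> (\<Pi>\<^sub>E i\<in>I. W i) \<and> finite {i\<in>I. ?f i \<noteq> \<zero>} \<and>
        x = (\<Oplus>i\<in>{i\<in>I. ?f i \<noteq> \<zero>}. ?f i)"
      unfolding supp using x by (simp add: D_def)
    show "\<exists>!f. f \<in> (\<Pi>\<^sub>E i\<in>I. W i) \<and> finite {i\<in>I. f i \<noteq> \<zero>} \<and> x = (\<Oplus>i\<in>{i\<in>I. f i \<noteq> \<zero>}. f i)"
    proof (rule ex1I[of _ ?f])
      show "?f \<in> (\<Pi>\<^sub>E i\<in>I. W i) \<and> finite {i\<in>I. ?f i \<noteq> \<zero>} \<and>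
        x = (\<Oplus>i\<in>{i\<in>I. ?f i \<noteq> \<zero>}. ?f i)"
        by (rule f)
    next
      fix g assume g: "g \<in> (\<Pi>\<^sub>E i\<in>I. W i) \<and> finite {i\<in>I. g i \<noteq> \<zero>} \<and>
        x = (\<Oplus>i\<in>{i\<in>I. g i \<noteq> \<zero>}. g i)"
      show "g = ?f"
      proof (rule PiE_ext[of _ I W])
        fix i assume "i \<in> I"
        then show "g i = ?f i"
          using unique[of g x i] g by simp
      qed (use f g in blast)+
    qed
  qed
qed


section \<open>Weight spaces\<close>

lemma alg_hom_zero:
  assumes "complex_algebra A" "complex_algebra B" "h \<in> alg_hom A B"
  shows "h \<zero>\<^bsub>A\<^esub> = \<zero>\<^bsub>B\<^esub>"
proof -
  interpret ring_hom_ring A B h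
    using assms by (rule alg_hom_ring_hom_ring)
  show ?thesis
    by (rule hom_zero)
qed

lemma alg_hom_finsum:
  assumes "complex_algebra A" "complex_algebra B" and h: "h \<in> alg_hom A B"
    and "finite S" "f \<in> S \<rightarrow> carrier A"
  shows "h (\<Oplus>\<^bsub>A\<^esub>i\<in>S. f i) = (\<Oplus>\<^bsub>B\<^esub>i\<in>S. h (f i))"
proof -
  interpret A: complex_algebra A by fact
  interpret B: complex_algebra B by fact
  show ?thesis
    using assms(4,5)
  proof (induction S)
    case (insert j S)
    then have "f j \<in> carrier A" "f \<in> S \<rightarrow> carrier A" "(\<lambda>i. h (f i)) \<in> S \<rightarrow> carrier B"
      by (auto intro: alg_homD(1)[OF h])
    with insert show ?case
      by (simp add: A.A.finsum_insert B.A.finsum_insert alg_homD[OF h])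
  qed (simp add: alg_hom_zero[OF assms(1-3)])
qed

section \<open>Words in the generators of SL_q(N)\<close>

lemma monoid_free_monoid: "Group.monoid (free_monoid X)"
  by (rule monoidI) (auto simp: free_monoid_def)

lemma slq_relators_subset:
  "slq_relators N q \<subseteq> carrier (monoid_algebra (free_monoid ({1..N} \<times> {1..N})))"
proof -
  let ?W = "lists ({1..N} \<times> {1..N})"
  have det: "Poly_Mapping.keys (quantum_det N q) \<subseteq> ?W"
  proof -
    have "quantum_det N q \<in> {p. Poly_Mapping.keys p \<subseteq> ?W}"
      unfolding quantum_det_def
    proof (rule lin_subspace_sum[OF lin_subspace_keys], rule CollectI)
      fix \<sigma> assume "\<sigma> \<in> {\<sigma>. \<sigma> permutes {1..N}}"
      then have "\<sigma> permutes {1..N}"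
        by (rule CollectD)
      then have "\<sigma> i \<in> {1..N}" if "i \<in> {1..N}" for i
        by (rule permutes_in_image[THEN iffD2]) (rule that)
      then have "map (\<lambda>i. (i, \<sigma> i)) [1..<Suc N] \<in> ?W"
        unfolding in_lists_conv_set by (auto simp del: upt_Suc)
      then show "Poly_Mapping.keys (Poly_Mapping.single (map (\<lambda>i. (i, \<sigma> i)) [1..<Suc N])
          ((- q) ^ inversions N \<sigma>)) \<subseteq> ?W"
        by simp
    qed
    then show ?thesis
      by simp
  qed
  have "slq_relators N q \<subseteq> {p. Poly_Mapping.keys p \<subseteq> ?W}"
    unfolding slq_relators_def
    by (intro Un_least; rule subsetI; rule CollectI; elim CollectE exE conjE singletonE; hypsubst;
        intro keys_diff_subset; simp add: det[simplified])
  then show ?thesis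
    by (simp add: free_monoid_def)
qed

lemma ideal_slq_ideal:
  "ideal (slq_ideal N q) (monoid_algebra (free_monoid ({1..N} \<times> {1..N})))"
proof -
  interpret complex_algebra "monoid_algebra (free_monoid ({1..N} \<times> {1..N}))"
    by (intro complex_algebra_monoid_algebra monoid_free_monoid)
  show ?thesis
    unfolding slq_ideal_def free_algebra_def by (rule A.genideal_ideal[OF slq_relators_subset])
qed

text \<open>The exponent vector of the torus monomial obtained by replacing each index i of the list
  by z_i.\<close>

definition content :: "nat list \<Rightarrow> nat \<Rightarrow>\<^sub>0 nat" where
  "content w = (\<Sum>i\<leftarrow>w. Poly_Mapping.single i 1)"

lemma content_simps: "content [] = 0" "content (i # w) = Poly_Mapping.single i 1 + content w"
  by (simp_all add: content_def)

lemma keys_content: "Poly_Mapping.keys (content w) \<subseteq> set w"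
proof (induction w)
  case (Cons i w)
  then show ?case
    using keys_add[of "Poly_Mapping.single i (1 :: nat)" "content w"] by (auto simp: content_simps)
qed (simp add: content_simps)

locale slq = torus N for N +
  fixes q :: complex and \<Delta> :: "slq \<Rightarrow> (slq \<times> slq \<Rightarrow>\<^sub>0 complex) set" and \<phi> :: "slq \<Rightarrow> torus"
  assumes \<Delta>: "is_slq_coproduct N q \<Delta>" and \<phi>: "is_torus_restriction N q \<phi>"
begin

abbreviation "Free \<equiv> monoid_algebra (free_monoid ({1..N} \<times> {1..N}))"
abbreviation "A \<equiv> SLq N q"
abbreviation "u i j \<equiv> slq_gen N q i j"
abbreviation "z \<equiv> torus_gen N"
abbreviation "L \<equiv> left_coaction N q \<Delta> \<phi>"
abbreviation "R \<equiv> right_coaction N q \<Delta> \<phi>"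

definition cls :: "((nat \<times> nat) list \<Rightarrow>\<^sub>0 complex) \<Rightarrow> slq" where
  "cls p = slq_ideal N q +>\<^bsub>Free\<^esub> p"

abbreviation word :: "(nat \<times> nat) list \<Rightarrow> slq" where
  "word w \<equiv> cls (Poly_Mapping.single w 1)"

sublocale Free: complex_algebra Free
  by (intro complex_algebra_monoid_algebra monoid_free_monoid)

lemma SLq_eq: "A = quotient_algebra Free (slq_ideal N q)"
  by (simp add: SLq_def free_algebra_def)

sublocale SL: complex_algebra A
  unfolding SLq_eq by (rule Free.complex_algebra_quotient[OF ideal_slq_ideal])

sublocale AA: tensor_product A A ..

sublocale KA: tensor_product K A ..

sublocale AK: tensor_product A K ..

lemma cls_hom: "cls \<in> alg_hom Free A"
  unfolding SLq_eq cls_def by (rule Free.coset_alg_hom[OF ideal_slq_ideal])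

lemma carrier_SLq: "carrier A = cls ` carrier Free"
  by (simp add: SLq_eq carrier_quotient_algebra cls_def)

lemma word_closed: "w \<in> lists ({1..N} \<times> {1..N}) \<Longrightarrow> word w \<in> carrier A"
  by (rule alg_homD(1)[OF cls_hom]) (simp add: free_monoid_def)

lemma word_Nil: "word [] = \<one>\<^bsub>A\<^esub>"
  using alg_homD(4)[OF cls_hom] by (simp add: free_monoid_def)

lemma word_Cons:
  assumes "x \<in> {1..N} \<times> {1..N}" "w \<in> lists ({1..N} \<times> {1..N})"
  shows "word (x # w) = u (fst x) (snd x) \<otimes>\<^bsub>A\<^esub> word w"
proof -
  have "u (fst x) (snd x) = word [x]"
    by (simp add: slq_gen_def cls_def free_algebra_def)
  moreover have "word [x] \<otimes>\<^bsub>A\<^esub> word w =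
      cls (Poly_Mapping.single [x] 1 \<otimes>\<^bsub>Free\<^esub> Poly_Mapping.single w 1)"
    by (rule alg_homD(2)[OF cls_hom, symmetric]) (use assms in \<open>simp_all add: free_monoid_def\<close>)
  ultimately show ?thesis
    by (simp add: free_monoid_def)
qed

lemma gen_closed: "i \<in> {1..N} \<Longrightarrow> j \<in> {1..N} \<Longrightarrow> u i j \<in> carrier A"
  using word_closed[of "[(i, j)]"] by (simp add: slq_gen_def cls_def free_algebra_def)

lemma coproduct_hom: "\<Delta> \<in> alg_hom A (tensor_algebra A A)"
  using \<Delta> by (simp add: is_slq_coproduct_def)

lemma restriction_hom: "\<phi> \<in> alg_hom A K"
  using \<phi> by (simp add: is_torus_restriction_def)

lemma restriction_gen:
  "i \<in> {1..N} \<Longrightarrow> j \<in> {1..N} \<Longrightarrow> \<phi> (u i j) = (if i = j then z i else \<zero>\<^bsub>K\<^esub>)"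
  using \<phi> by (auto simp: is_torus_restriction_def)

lemmas tensor_left = alg_hom_tensor_map[OF SL.complex_algebra_axioms SL.complex_algebra_axioms
    KC.complex_algebra_axioms SL.complex_algebra_axioms restriction_hom alg_hom_id]
  and tensor_right = alg_hom_tensor_map[OF SL.complex_algebra_axioms SL.complex_algebra_axioms
    SL.complex_algebra_axioms KC.complex_algebra_axioms alg_hom_id restriction_hom]

lemma left_hom: "L \<in> alg_hom A (tensor_algebra K A)"
  unfolding left_coaction_def by (rule alg_hom_comp[OF coproduct_hom tensor_left(1)])

lemma right_hom: "R \<in> alg_hom A (tensor_algebra A K)"
  unfolding right_coaction_def by (rule alg_hom_comp[OF coproduct_hom tensor_right(1)])

section \<open>The coactions on generators and words\<close>

lemma coproduct_gen:
  assumes "i \<in> {1..N}" "j \<in> {1..N}"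
  shows "\<Delta> (u i j) = (\<Oplus>\<^bsub>tensor_algebra A A\<^esub>k\<in>{1..N}. pure_tensor A A (u i k) (u k j))"
  using \<Delta> assms by (auto simp: is_slq_coproduct_def)

text \<open>In the coproduct of \<open>u i j\<close> the map \<open>\<phi>\<close> annihilates every
  left factor \<open>u i k\<close> except the diagonal one, so only k = i survives. On the right
  side it is k = j.\<close>

lemma left_gen:
  assumes "i \<in> {1..N}" "j \<in> {1..N}"
  shows "L (u i j) = pure_tensor K A (z i) (u i j)"
proof -
  have "L (u i j) = (\<Oplus>\<^bsub>tensor_algebra K A\<^esub>k\<in>{1..N}.
      tensor_map K A \<phi> id (pure_tensor A A (u i k) (u k j)))"
    unfolding left_coaction_def comp_apply coproduct_gen[OF assms]
    by (rule alg_hom_finsum[OF AA.T.complex_algebra_axioms KA.T.complex_algebra_axioms tensor_left(1)])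
      (use assms gen_closed in auto)
  also have "\<dots> = (\<Oplus>\<^bsub>tensor_algebra K A\<^esub>k\<in>{1..N}.
      if i = k then pure_tensor K A (z k) (u k j) else \<zero>\<^bsub>tensor_algebra K A\<^esub>)"
  proof (rule KA.T.A.add.finprod_cong')
    fix k assume "k \<in> {1..N}"
    then show "tensor_map K A \<phi> id (pure_tensor A A (u i k) (u k j)) =
        (if i = k then pure_tensor K A (z k) (u k j) else \<zero>\<^bsub>tensor_algebra K A\<^esub>)"
      using assms by (simp add: tensor_left(2) gen_closed restriction_gen KA.pure_zero_left)
  qed (use assms gen_closed torus_gen_closed in auto)
  also have "\<dots> = pure_tensor K A (z i) (u i j)"
    by (rule KA.T.A.finsum_singleton) (use assms gen_closed torus_gen_closed in auto)
  finally show ?thesis .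
qed

lemma right_gen:
  assumes "i \<in> {1..N}" "j \<in> {1..N}"
  shows "R (u i j) = pure_tensor A K (u i j) (z j)"
proof -
  have "R (u i j) = (\<Oplus>\<^bsub>tensor_algebra A K\<^esub>k\<in>{1..N}.
      tensor_map A K id \<phi> (pure_tensor A A (u i k) (u k j)))"
    unfolding right_coaction_def comp_apply coproduct_gen[OF assms]
    by (rule alg_hom_finsum[OF AA.T.complex_algebra_axioms AK.T.complex_algebra_axioms tensor_right(1)])
      (use assms gen_closed in auto)
  also have "\<dots> = (\<Oplus>\<^bsub>tensor_algebra A K\<^esub>k\<in>{1..N}.
      if j = k then pure_tensor A K (u i k) (z k) else \<zero>\<^bsub>tensor_algebra A K\<^esub>)"
  proof (rule AK.T.A.add.finprod_cong')
    fix k assume "k \<in> {1..N}"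
    then show "tensor_map A K id \<phi> (pure_tensor A A (u i k) (u k j)) =
        (if j = k then pure_tensor A K (u i k) (z k) else \<zero>\<^bsub>tensor_algebra A K\<^esub>)"
      using assms by (simp add: tensor_right(2) gen_closed restriction_gen AK.pure_zero_right)
  qed (use assms gen_closed torus_gen_closed in auto)
  also have "\<dots> = pure_tensor A K (u i j) (z j)"
    by (rule AK.T.A.finsum_singleton) (use assms gen_closed torus_gen_closed in auto)
  finally show ?thesis .
qed

lemma mon_content_Cons:
  assumes "i \<in> {1..N}" "set w \<subseteq> {1..N}"
  shows "mon (content (i # w)) = z i \<otimes>\<^bsub>K\<^esub> mon (content w)"
  unfolding content_simps torus_gen_eq
  by (rule mon_add) (use assms keys_content[of w] in auto)

lemma mon_content_closed: "set w \<subseteq> {1..N} \<Longrightarrow> mon (content w) \<in> carrier K"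
  using keys_content[of w] by (intro mon_closed) auto

text \<open>The coaction is multiplicative and the tensor product is multiplied factor by factor, so
  the row indices accumulate in the torus factor while the word is rebuilt in the other.\<close>

lemma left_word:
  assumes "w \<in> lists ({1..N} \<times> {1..N})"
  shows "L (word w) = pure_tensor K A (mon (content (map fst w))) (word w)"
  using assms
proof (induction w)
  case Nil
  show ?case
    unfolding word_Nil list.map content_simps mon_zero
    by (simp only: alg_homD(4)[OF left_hom] KA.pure_one)
next
  case (Cons x w)
  then have x: "fst x \<in> {1..N}" "snd x \<in> {1..N}" and w: "w \<in> lists ({1..N} \<times> {1..N})"
    and s: "set (map fst w) \<subseteq> {1..N}"
    by (auto simp: in_lists_conv_set)
  have "L (word (x # w)) = L (u (fst x) (snd x)) \<otimes>\<^bsub>tensor_algebra K A\<^esub> L (word w)"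
    using Cons.hyps(1) w x by (simp only: word_Cons alg_homD(2)[OF left_hom] gen_closed word_closed)
  also have "\<dots> = pure_tensor K A (mon (content (fst x # map fst w))) (word (x # w))"
    unfolding left_gen[OF x] Cons.IH mon_content_Cons[OF x(1) s] word_Cons[OF Cons.hyps(1) w]
    by (intro KA.pure_mult torus_gen_closed x gen_closed mon_content_closed s word_closed w)
  finally show ?case
    by simp
qed

lemma right_word:
  assumes "w \<in> lists ({1..N} \<times> {1..N})"
  shows "R (word w) = pure_tensor A K (word w) (mon (content (map snd w)))"
  using assms
proof (induction w)
  case Nil
  show ?case
    unfolding word_Nil list.map content_simps mon_zero
    by (simp only: alg_homD(4)[OF right_hom] AK.pure_one)
next
  case (Cons x w)
  then have x: "fst x \<in> {1..N}" "snd x \<in> {1..N}" and w: "w \<in> lists ({1..N} \<times> {1..N})"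
    and s: "set (map snd w) \<subseteq> {1..N}"
    by (auto simp: in_lists_conv_set)
  have "R (word (x # w)) = R (u (fst x) (snd x)) \<otimes>\<^bsub>tensor_algebra A K\<^esub> R (word w)"
    using Cons.hyps(1) w x by (simp only: word_Cons alg_homD(2)[OF right_hom] gen_closed word_closed)
  also have "\<dots> = pure_tensor A K (word (x # w)) (mon (content (snd x # map snd w)))"
    unfolding right_gen[OF x] Cons.IH mon_content_Cons[OF x(2) s] word_Cons[OF Cons.hyps(1) w]
    by (intro AK.pure_mult torus_gen_closed x gen_closed mon_content_closed s word_closed w)
  finally show ?case
    by simp
qed

section \<open>Weight spaces as subspaces, and their span\<close>

abbreviation "W \<equiv> weight_space N q \<Delta> \<phi>"

lemma word_weight_space:
  assumes "w \<in> lists ({1..N} \<times> {1..N})"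
  shows "word w \<in> W (weight N (content (map fst w))) (weight N (content (map snd w)))"
proof -
  have "set (map fst w) \<subseteq> {1..N}" "set (map snd w) \<subseteq> {1..N}"
    using assms by (auto simp: in_lists_conv_set)
  then have "Poly_Mapping.keys (content (map fst w)) \<subseteq> {1..N}"
      "Poly_Mapping.keys (content (map snd w)) \<subseteq> {1..N}"
    using keys_content by (meson subset_trans)+
  then show ?thesis
    by (simp add: weight_space_def left_word[OF assms] right_word[OF assms] word_closed[OF assms]
        torus_monom_weight)
qed

lemma weight_space_zero: "\<zero>\<^bsub>A\<^esub> \<in> W \<alpha> \<beta>"
  by (simp add: weight_space_def torus_monom_closed KA.pure_zero_right AK.pure_zero_left
      alg_hom_zero[OF SL.complex_algebra_axioms KA.T.complex_algebra_axioms left_hom]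
      alg_hom_zero[OF SL.complex_algebra_axioms AK.T.complex_algebra_axioms right_hom])

lemma weight_space_add: "x \<in> W \<alpha> \<beta> \<Longrightarrow> y \<in> W \<alpha> \<beta> \<Longrightarrow> x \<oplus>\<^bsub>A\<^esub> y \<in> W \<alpha> \<beta>"
  by (simp add: weight_space_def torus_monom_closed KA.pure_add_right AK.pure_add_left
      alg_homD(3)[OF left_hom] alg_homD(3)[OF right_hom])

lemma weight_space_smult: "x \<in> W \<alpha> \<beta> \<Longrightarrow> c \<odot>\<^bsub>A\<^esub> x \<in> W \<alpha> \<beta>"
  by (simp add: weight_space_def torus_monom_closed KA.pure_smult_right AK.pure_smult_left
      alg_homD(5)[OF left_hom] alg_homD(5)[OF right_hom])

lemma weight_space_subset: "W \<alpha> \<beta> \<subseteq> carrier A"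
  by (auto simp: weight_space_def)

lemma weight_space_submodule: "submodule (W \<alpha> \<beta>) complex_ring A"
  by (intro SL.submoduleI' weight_space_subset weight_space_zero weight_space_add weight_space_smult)

text \<open>Each element is the class of a finite combination of words, and every scalar multiple of
  a word lies in a weight space. The set \<open>S\<close> is therefore only asked to be closed under
  addition, as \<open>internal_direct_sumI\<close> demands.\<close>

lemma weight_spaces_span:
  assumes "\<zero>\<^bsub>A\<^esub> \<in> S" "\<And>x y. x \<in> S \<Longrightarrow> y \<in> S \<Longrightarrow> x \<oplus>\<^bsub>A\<^esub> y \<in> S"
    and "\<And>\<alpha> \<beta>. \<alpha> \<in> weights N \<Longrightarrow> \<beta> \<in> weights N \<Longrightarrow> W \<alpha> \<beta> \<subseteq> S"
  shows "carrier A \<subseteq> S"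
proof
  fix x assume "x \<in> carrier A"
  then obtain p where p: "Poly_Mapping.keys p \<subseteq> lists ({1..N} \<times> {1..N})" and x: "x = cls p"
    unfolding carrier_SLq by (elim imageE) (simp add: free_monoid_def)
  have scaled: "Poly_Mapping.single w c \<in> carrier Free \<and> cls (Poly_Mapping.single w c) \<in> S"
    if w: "w \<in> lists ({1..N} \<times> {1..N})" for w c
  proof
    show "Poly_Mapping.single w c \<in> carrier Free"
      using w by (simp add: free_monoid_def)
    have "cls (c \<odot>\<^bsub>Free\<^esub> Poly_Mapping.single w 1) = c \<odot>\<^bsub>A\<^esub> word w"
      by (rule alg_homD(5)[OF cls_hom]) (use w in \<open>simp add: free_monoid_def\<close>)
    moreover have "c \<odot>\<^bsub>A\<^esub> word w \<in> S"
      by (rule subsetD[OF assms(3) weight_space_smult[OF word_weight_space[OF w]]])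
        (rule weight_in_weights)+
    ultimately show "cls (Poly_Mapping.single w c) \<in> S"
      by simp
  qed
  \<comment> \<open>Membership in the carrier is carried through the induction because
    \<open>cls\<close> is known to be additive only there.\<close>
  have "(\<Sum>w\<in>T. Poly_Mapping.single w (c w)) \<in> carrier Free \<and>
      cls (\<Sum>w\<in>T. Poly_Mapping.single w (c w)) \<in> S"
    if "finite T" "T \<subseteq> lists ({1..N} \<times> {1..N})" for T c
    using that
  proof (induction T)
    case empty
    then show ?case
      using alg_hom_zero[OF Free.complex_algebra_axioms SL.complex_algebra_axioms cls_hom] assms(1)
      by simp
  next
    case (insert w T)
    let ?s = "\<Sum>w\<in>T. Poly_Mapping.single w (c w)"
    have s: "?s \<in> carrier Free" "cls ?s \<in> S"
      using insert by simp_all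
    have w: "Poly_Mapping.single w (c w) \<in> carrier Free" "cls (Poly_Mapping.single w (c w)) \<in> S"
      using scaled[of w "c w"] insert.prems by simp_all
    show ?case
      using alg_homD(3)[OF cls_hom w(1) s(1)] assms(2)[OF w(2) s(2)] Free.A.a_closed[OF w(1) s(1)]
        insert.hyps by simp
  qed
  from this[OF finite_keys p, of "Poly_Mapping.lookup p"] show "x \<in> S"
    using lin_ext_basis[of p, unfolded lin_ext_def scale_single mult_1_right] by (simp add: x)
qed

section \<open>Projections onto weights, and the direct sum\<close>

lemma left_projection:
  obtains P where "\<And>x. x \<in> carrier A \<Longrightarrow> P x \<in> carrier A"
    and "\<And>x y. x \<in> carrier A \<Longrightarrow> y \<in> carrier A \<Longrightarrow> P (x \<oplus>\<^bsub>A\<^esub> y) = P x \<oplus>\<^bsub>A\<^esub> P y"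
    and "\<And>\<gamma> \<beta> x. \<gamma> \<in> weights N \<Longrightarrow> x \<in> W \<gamma> \<beta> \<Longrightarrow> P x = (if \<gamma> = \<alpha> then x else \<zero>\<^bsub>A\<^esub>)"
proof -
  obtain e :: "torus \<Rightarrow> complex" where e:
    "\<And>x y. x \<in> carrier K \<Longrightarrow> y \<in> carrier K \<Longrightarrow> e (x \<oplus>\<^bsub>K\<^esub> y) = e x + e y"
    "\<And>c x. x \<in> carrier K \<Longrightarrow> e (c \<odot>\<^bsub>K\<^esub> x) = c * e x"
    "\<And>\<gamma>. \<gamma> \<in> weights N \<Longrightarrow> e (torus_monom N \<gamma>) = (if \<gamma> = \<alpha> then 1 else 0)"
    using torus_coefficient[of \<alpha>] by blast
  \<comment> \<open>The map \<open>e\<close> tensored with the identity ends in the tensor product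
    of the complex numbers with \<open>A\<close>; scalar multiplication identifies this with
    \<open>A\<close>, whence the bilinear map sending k, a to \<open>e k\<close> times a.\<close>
  obtain h where h: "\<And>x. x \<in> carrier (tensor_algebra K A) \<Longrightarrow> h x \<in> carrier A"
    "\<And>x y. x \<in> carrier (tensor_algebra K A) \<Longrightarrow> y \<in> carrier (tensor_algebra K A) \<Longrightarrow>
       h (x \<oplus>\<^bsub>tensor_algebra K A\<^esub> y) = h x \<oplus>\<^bsub>A\<^esub> h y"
    "\<And>k a. k \<in> carrier K \<Longrightarrow> a \<in> carrier A \<Longrightarrow> h (pure_tensor K A k a) = e k \<odot>\<^bsub>A\<^esub> a"
    by (rule KA.tensor_lift[OF monoid_free_monoid ideal_slq_ideal[of N q], folded SLq_eq, of "\<lambda>k a. e k \<odot>\<^bsub>A\<^esub> a"])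
      ((simp add: e SL.smult_l_distr[simplified] SL.smult_r_distr[simplified]
          SL.smult_assoc1[simplified, symmetric] mult.commute; fail) | blast)+
  show thesis
  proof (rule that[of "\<lambda>x. h (L x)"])
    fix \<gamma> \<beta> x assume "\<gamma> \<in> weights N" "x \<in> W \<gamma> \<beta>"
    then show "h (L x) = (if \<gamma> = \<alpha> then x else \<zero>\<^bsub>A\<^esub>)"
      by (simp add: weight_space_def h(3) torus_monom_closed e(3))
  qed (simp_all add: h alg_homD[OF left_hom])
qed

lemma right_projection:
  obtains P where "\<And>x. x \<in> carrier A \<Longrightarrow> P x \<in> carrier A"
    and "\<And>x y. x \<in> carrier A \<Longrightarrow> y \<in> carrier A \<Longrightarrow> P (x \<oplus>\<^bsub>A\<^esub> y) = P x \<oplus>\<^bsub>A\<^esub> P y"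
    and "\<And>\<gamma> \<alpha> x. \<gamma> \<in> weights N \<Longrightarrow> x \<in> W \<alpha> \<gamma> \<Longrightarrow> P x = (if \<gamma> = \<beta> then x else \<zero>\<^bsub>A\<^esub>)"
proof -
  obtain e :: "torus \<Rightarrow> complex" where e:
    "\<And>x y. x \<in> carrier K \<Longrightarrow> y \<in> carrier K \<Longrightarrow> e (x \<oplus>\<^bsub>K\<^esub> y) = e x + e y"
    "\<And>c x. x \<in> carrier K \<Longrightarrow> e (c \<odot>\<^bsub>K\<^esub> x) = c * e x"
    "\<And>\<gamma>. \<gamma> \<in> weights N \<Longrightarrow> e (torus_monom N \<gamma>) = (if \<gamma> = \<beta> then 1 else 0)"
    using torus_coefficient[of \<beta>] by blast
  obtain h where h: "\<And>x. x \<in> carrier (tensor_algebra A K) \<Longrightarrow> h x \<in> carrier A"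
    "\<And>x y. x \<in> carrier (tensor_algebra A K) \<Longrightarrow> y \<in> carrier (tensor_algebra A K) \<Longrightarrow>
       h (x \<oplus>\<^bsub>tensor_algebra A K\<^esub> y) = h x \<oplus>\<^bsub>A\<^esub> h y"
    "\<And>a k. a \<in> carrier A \<Longrightarrow> k \<in> carrier K \<Longrightarrow> h (pure_tensor A K a k) = e k \<odot>\<^bsub>A\<^esub> a"
    by (rule AK.tensor_lift[OF monoid_free_monoid ideal_slq_ideal[of N q], folded SLq_eq, of "\<lambda>a k. e k \<odot>\<^bsub>A\<^esub> a"])
      ((simp add: e SL.smult_l_distr[simplified] SL.smult_r_distr[simplified]
          SL.smult_assoc1[simplified, symmetric] mult.commute; fail) | blast)+
  show thesis
  proof (rule that[of "\<lambda>x. h (R x)"])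
    fix \<gamma> \<alpha> x assume "\<gamma> \<in> weights N" "x \<in> W \<alpha> \<gamma>"
    then show "h (R x) = (if \<gamma> = \<beta> then x else \<zero>\<^bsub>A\<^esub>)"
      by (simp add: weight_space_def h(3) torus_monom_closed e(3))
  qed (simp_all add: h alg_homD[OF right_hom])
qed

lemma weight_decomposition:
  "internal_direct_sum complex_ring A (weights N \<times> weights N) (\<lambda>(\<alpha>, \<beta>). W \<alpha> \<beta>)"
proof -
  \<comment> \<open>The projection exists for each \<open>\<alpha>\<close> separately. Its
    properties are packed into one predicate so that the axiom of choice gives a whole
    family.\<close>
  define left_proj where "left_proj \<alpha> P \<longleftrightarrow> (\<forall>x\<in>carrier A. P x \<in> carrier A) \<and>
      (\<forall>x\<in>carrier A. \<forall>y\<in>carrier A. P (x \<oplus>\<^bsub>A\<^esub> y) = P x \<oplus>\<^bsub>A\<^esub> P y) \<and>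
      (\<forall>\<gamma>\<in>weights N. \<forall>\<beta>. \<forall>x\<in>W \<gamma> \<beta>. P x = (if \<gamma> = \<alpha> then x else \<zero>\<^bsub>A\<^esub>))" for \<alpha> P
  have "\<forall>\<alpha>. \<exists>P. left_proj \<alpha> P"
  proof
    fix \<alpha>
    show "\<exists>P. left_proj \<alpha> P"
    proof (rule left_projection[of \<alpha>])
      fix P assume "\<And>x. x \<in> carrier A \<Longrightarrow> P x \<in> carrier A"
        and "\<And>x y. x \<in> carrier A \<Longrightarrow> y \<in> carrier A \<Longrightarrow> P (x \<oplus>\<^bsub>A\<^esub> y) = P x \<oplus>\<^bsub>A\<^esub> P y"
        and "\<And>\<gamma> \<delta> x. \<gamma> \<in> weights N \<Longrightarrow> x \<in> W \<gamma> \<delta> \<Longrightarrow>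
          P x = (if \<gamma> = \<alpha> then x else \<zero>\<^bsub>A\<^esub>)"
      then show "\<exists>P. left_proj \<alpha> P"
        unfolding left_proj_def by (intro exI[of _ P] conjI ballI allI)
    qed
  qed
  then obtain P where "\<forall>\<alpha>. left_proj \<alpha> (P \<alpha>)"
    by (rule choice[THEN exE])
  then have P: "\<And>\<alpha> x. x \<in> carrier A \<Longrightarrow> P \<alpha> x \<in> carrier A"
    "\<And>\<alpha> x y. x \<in> carrier A \<Longrightarrow> y \<in> carrier A \<Longrightarrow> P \<alpha> (x \<oplus>\<^bsub>A\<^esub> y) = P \<alpha> x \<oplus>\<^bsub>A\<^esub> P \<alpha> y"
    "\<And>\<alpha> \<gamma> \<beta> x. \<gamma> \<in> weights N \<Longrightarrow> x \<in> W \<gamma> \<beta> \<Longrightarrow> P \<alpha> x = (if \<gamma> = \<alpha> then x else \<zero>\<^bsub>A\<^esub>)"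
    unfolding left_proj_def by blast+
  define right_proj where "right_proj \<beta> Q \<longleftrightarrow> (\<forall>x\<in>carrier A. Q x \<in> carrier A) \<and>
      (\<forall>x\<in>carrier A. \<forall>y\<in>carrier A. Q (x \<oplus>\<^bsub>A\<^esub> y) = Q x \<oplus>\<^bsub>A\<^esub> Q y) \<and>
      (\<forall>\<gamma>\<in>weights N. \<forall>\<alpha>. \<forall>x\<in>W \<alpha> \<gamma>. Q x = (if \<gamma> = \<beta> then x else \<zero>\<^bsub>A\<^esub>))" for \<beta> Q
  have "\<forall>\<beta>. \<exists>Q. right_proj \<beta> Q"
  proof
    fix \<beta>
    show "\<exists>Q. right_proj \<beta> Q"
    proof (rule right_projection[of \<beta>])
      fix Q assume "\<And>x. x \<in> carrier A \<Longrightarrow> Q x \<in> carrier A"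
        and "\<And>x y. x \<in> carrier A \<Longrightarrow> y \<in> carrier A \<Longrightarrow> Q (x \<oplus>\<^bsub>A\<^esub> y) = Q x \<oplus>\<^bsub>A\<^esub> Q y"
        and "\<And>\<gamma> \<delta> x. \<gamma> \<in> weights N \<Longrightarrow> x \<in> W \<delta> \<gamma> \<Longrightarrow>
          Q x = (if \<gamma> = \<beta> then x else \<zero>\<^bsub>A\<^esub>)"
      then show "\<exists>Q. right_proj \<beta> Q"
        unfolding right_proj_def by (intro exI[of _ Q] conjI ballI allI)
    qed
  qed
  then obtain Q where "\<forall>\<beta>. right_proj \<beta> (Q \<beta>)"
    by (rule choice[THEN exE])
  then have Q: "\<And>\<beta> x. x \<in> carrier A \<Longrightarrow> Q \<beta> x \<in> carrier A"
    "\<And>\<beta> x y. x \<in> carrier A \<Longrightarrow> y \<in> carrier A \<Longrightarrow> Q \<beta> (x \<oplus>\<^bsub>A\<^esub> y) = Q \<beta> x \<oplus>\<^bsub>A\<^esub> Q \<beta> y"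
    "\<And>\<beta> \<gamma> \<alpha> x. \<gamma> \<in> weights N \<Longrightarrow> x \<in> W \<alpha> \<gamma> \<Longrightarrow> Q \<beta> x = (if \<gamma> = \<beta> then x else \<zero>\<^bsub>A\<^esub>)"
    unfolding right_proj_def by blast+
  show ?thesis
  \<comment> \<open>On a weight vector \<open>P \<alpha>\<close> returns the vector itself or zero,
    so the result is still a weight vector to which the property of \<open>Q \<beta>\<close>
    applies. The composite thus selects exactly one pair of weights.\<close>
  proof (rule internal_direct_sumI[OF SL.A.abelian_monoid_axioms, where \<pi> = "\<lambda>(\<alpha>, \<beta>) x. Q \<beta> (P \<alpha> x)"], goal_cases)
    case (1 i)
    show ?case
      by (simp add: case_prod_beta weight_space_submodule)
  next
    case (2 i)
    show ?case
      by (simp add: case_prod_beta weight_space_subset)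
  next
    case (3 i)
    show ?case
      by (simp add: case_prod_beta weight_space_zero)
  next
    case (4 i x y)
    then show ?case
      by (simp add: case_prod_beta weight_space_add)
  next
    case (5 i x)
    then show ?case
      by (simp add: case_prod_beta P(1) Q(1))
  next
    case (6 i x y)
    then show ?case
      by (simp add: case_prod_beta P(1,2) Q(2))
  next
    case (7 i j x)
    obtain \<alpha> \<beta> \<alpha>' \<beta>' where ij: "i = (\<alpha>, \<beta>)" "j = (\<alpha>', \<beta>')"
      by (metis surj_pair)
    then have *: "\<beta> \<in> weights N" "\<alpha>' \<in> weights N" "\<beta>' \<in> weights N" "x \<in> W \<alpha>' \<beta>'"
      using 7 by simp_all
    \<comment> \<open>Zero lies in every weight space, so the defining property of
      \<open>Q \<beta>\<close> evaluates it there, and either branch gives zero.\<close>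
    have "Q \<beta> \<zero>\<^bsub>A\<^esub> = \<zero>\<^bsub>A\<^esub>"
      using Q(3)[OF *(1) weight_space_zero] by simp
    then show ?case
      using P(3)[OF *(2,4)] Q(3)[OF *(3,4)] by (simp add: ij)
  next
    case (8 S)
    show ?case
    proof (rule weight_spaces_span)
      fix \<alpha> \<beta> assume "\<alpha> \<in> weights N" "\<beta> \<in> weights N"
      then show "W \<alpha> \<beta> \<subseteq> S"
        using 8(3)[of "(\<alpha>, \<beta>)"] by simp
    qed (use 8 in blast)+
  qed
qed

end

theorem mainTheorem1:
  fixes N :: nat and q :: complex
    and \<Delta> :: "slq \<Rightarrow> (slq \<times> slq \<Rightarrow>\<^sub>0 complex) set"
    and \<phi> :: "slq \<Rightarrow> torus"
  assumes "N \<ge> 2" and "q \<noteq> 0"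
    and "is_slq_coproduct N q \<Delta>"
    and "is_torus_restriction N q \<phi>"
  shows "internal_direct_sum complex_ring (SLq N q) (weights N \<times> weights N)
           (\<lambda>(\<alpha>, \<beta>). weight_space N q \<Delta> \<phi> \<alpha> \<beta>)"
proof -
  interpret slq N q \<Delta> \<phi>
    using assms by unfold_locales simp_all
  show ?thesis
    by (rule weight_decomposition)
qed

end
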